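(* Let $J$ be an infinite set. The group $\mathbb P_J$ acts (via $\alpha$) as a large group of automorphisms on $\mathrm{CAR}(J)$, and the $C^*$-dynamical system $(\mathrm{CAR}(J),\mathbb P_J,\alpha)$ is $\mathbb P_J$-abelian.
   Context: $\mathrm{CAR}(J)$ is the unital $C^*$-algebra generated by $\{a_j,a_j^\dagger : j\in J\}$ with $(a_j)^*=a_j^\dagger$, $\{a_j^\dagger,a_k\}=\delta_{jk}1$, $\{a_j,a_k\}=\{a_j^\dagger,a_k^\dagger\}=0$, where $\{a,b\}=ab+ba$. $\mathbb P_J$ is the group of permutations of $J$ moving only finitely many elements; it acts on $\mathrm{CAR}(J)$ by the automorphisms $\alpha_g$ determined by $\alpha_g(a_j)=a_{gj}$. Let a group $G$ act by automorphisms $\alpha_g$ on a unital $C^*$-algebra $\mathfrak A$, and let $\mathcal S_G(\mathfrak A)$ be the set of $G$-invariant states. For $\varphi\in\mathcal S_G(\mathfrak A)$ let $(\pi_\varphi,\mathcal H_\varphi,U_\varphi,\Omega_\varphi)$ be the covariant GNS quadruple: $(\pi_\varphi,\mathcal H_\varphi,\Omega_\varphi)$ is the GNS triple and $U_\varphi$ is the unitary representation of $G$ with $\pi_\varphi(\alpha_g(A))=U_\varphi(g)\pi_\varphi(A)U_\varphi(g)^{-1}$ and $U_\varphi(g)\Omega_\varphi=\Omega_\varphi$. Let $E_\varphi$ be the orthogonal projection onto $\{\xi\in\mathcal H_\varphi : U_\varphi(g)\xi=\xi,\ g\in G\}$. $G$ acts as a large group of automorphisms if, for each selfadjoint $A\in\mathfrak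 A$ and each $\varphi\in\mathcal S_G(\mathfrak A)$, $$\overline{\mathrm{conv}\{\pi_\varphi(\alpha_g(A)) : g\in G\}}\cap\pi_\varphi(\mathfrak A)'\neq\emptyset,$$ the closure being in the weak operator topology. The system $(\mathfrak A,G,\alpha)$ is $G$-abelian if for each $\varphi\in\mathcal S_G(\mathfrak A)$ the operators in $E_\varphi\pi_\varphi(\mathfrak A)E_\varphi$ mutually commute. *)

theory Defs
  imports "HOL-Analysis.Analysis" "HOL-Algebra.Group" "HOL-Combinatorics.Permutations"
begin

section \<open>Unital \<open>C\<^sup>*\<close>-algebras and complex Hilbert spaces\<close>

class complex_vector = real_vector +
  fixes scaleC :: "complex \<Rightarrow> 'a \<Rightarrow> 'a" (infixr "*\<^sub>C" 75)
  assumes scaleC_add_right: "c *\<^sub>C (x + y) = c *\<^sub>C x + c *\<^sub>C y"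
    and scaleC_add_left: "(c + d) *\<^sub>C x = c *\<^sub>C x + d *\<^sub>C x"
    and scaleC_scaleC: "c *\<^sub>C d *\<^sub>C x = (c * d) *\<^sub>C x"
    and scaleR_scaleC: "r *\<^sub>R x = complex_of_real r *\<^sub>C x"

class cstar_algebra = complex_vector + real_normed_algebra_1 + banach +
  fixes star :: "'a \<Rightarrow> 'a"
  assumes mult_scaleC_left: "(c *\<^sub>C x) * y = c *\<^sub>C (x * y)"
    and mult_scaleC_right: "x * (c *\<^sub>C y) = c *\<^sub>C (x * y)"
    and norm_scaleC: "norm (c *\<^sub>C x) = cmod c * norm x"
    and star_add: "star (x + y) = star x + star y"
    and star_scaleC: "star (c *\<^sub>C x) = cnj c *\<^sub>C star x"
    and star_mult: "star (x * y) = star y * star x"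
    and star_star: "star (star x) = x"
    and cstar_identity: "norm (star x * x) = (norm x)\<^sup>2"

text \<open>The inner product is conjugate-linear in the first argument. Its real part is the
  inner product of the underlying real Hilbert space, so norm and topology are those of
  \<^class>\<open>real_inner\<close>.\<close>

class complex_hilbert = complex_vector + real_inner + banach +
  fixes cinner :: "'a \<Rightarrow> 'a \<Rightarrow> complex"
  assumes cinner_add_right: "cinner x (y + z) = cinner x y + cinner x z"
    and cinner_scaleC_right: "cinner x (c *\<^sub>C y) = c * cinner x y"
    and cinner_commute: "cinner x y = cnj (cinner y x)"
    and inner_eq_Re_cinner: "inner x y = Re (cinner x y)"

definition csubspace :: "'a::complex_vector set \<Rightarrow> bool" where
  "csubspace S \<longleftrightarrow>
     0 \<in> S \<and> (\<forall>x\<in>S. \<forall>y\<in>S. x + y \<in> S) \<and> (\<forall>c. \<forall>x\<in>S. c *\<^sub>C x \<in> S)"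

text \<open>A type cannot depend on a state, so the Hilbert space of a representation is a closed
  complex subspace \<open>H\<close> of a type of class \<^class>\<open>complex_hilbert\<close> (possibly the whole type).
  Operators on \<open>H\<close> are functions on the ambient type of which only the values on \<open>H\<close> matter.\<close>

definition bounded_ops :: "'h::complex_hilbert set \<Rightarrow> ('h \<Rightarrow> 'h) set" where
  "bounded_ops H = {T. (\<forall>x\<in>H. T x \<in> H)
     \<and> (\<forall>x\<in>H. \<forall>y\<in>H. T (x + y) = T x + T y)
     \<and> (\<forall>c. \<forall>x\<in>H. T (c *\<^sub>C x) = c *\<^sub>C T x)
     \<and> (\<exists>K. \<forall>x\<in>H. norm (T x) \<le> K * norm x)}"

definition unitary_ops :: "'h::complex_hilbert set \<Rightarrow> ('h \<Rightarrow> 'h) set" where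
  "unitary_ops H =
     {V \<in> bounded_ops H. V ` H = H \<and> (\<forall>x\<in>H. \<forall>y\<in>H. cinner (V x) (V y) = cinner x y)}"

definition weak_operator_topology :: "'h::complex_hilbert set \<Rightarrow> ('h \<Rightarrow> 'h) topology" where
  "weak_operator_topology H = topology_generated_by
     {{T \<in> bounded_ops H. cinner x (T y) \<in> V} | x y V. x \<in> H \<and> y \<in> H \<and> open V}"

definition conv_ops :: "('h::complex_hilbert \<Rightarrow> 'h) set \<Rightarrow> ('h \<Rightarrow> 'h) set" where
  "conv_ops S = {(\<lambda>x. \<Sum>T\<in>F. t T *\<^sub>R T x) | F t.
     finite F \<and> F \<subseteq> S \<and> (\<forall>T\<in>F. 0 \<le> t T) \<and> sum t F = 1}"

definition commutant :: "'h::complex_hilbert set \<Rightarrow> ('h \<Rightarrow> 'h) set \<Rightarrow> ('h \<Rightarrow> 'h) set" where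
  "commutant H S = {T \<in> bounded_ops H. \<forall>R\<in>S. \<forall>x\<in>H. T (R x) = R (T x)}"

definition orth_proj :: "'h::complex_hilbert set \<Rightarrow> 'h \<Rightarrow> 'h" where
  "orth_proj M x = (THE p. p \<in> M \<and> (\<forall>y\<in>M. cinner y (x - p) = 0))"


section \<open>Group actions, invariant states and covariant GNS representations\<close>

definition star_automorphism :: "('a::cstar_algebra \<Rightarrow> 'a) \<Rightarrow> bool" where
  "star_automorphism f \<longleftrightarrow> bij f
     \<and> (\<forall>A B. f (A + B) = f A + f B) \<and> (\<forall>c A. f (c *\<^sub>C A) = c *\<^sub>C f A)
     \<and> (\<forall>A B. f (A * B) = f A * f B) \<and> (\<forall>A. f (star A) = star (f A))"

definition cstar_action ::
    "('g, 'm) monoid_scheme \<Rightarrow> ('g \<Rightarrow> 'a::cstar_algebra \<Rightarrow> 'a) \<Rightarrow> bool" where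
  "cstar_action G \<alpha> \<longleftrightarrow> group G
     \<and> (\<forall>g\<in>carrier G. star_automorphism (\<alpha> g))
     \<and> (\<forall>g\<in>carrier G. \<forall>h\<in>carrier G. \<alpha> (g \<otimes>\<^bsub>G\<^esub> h) = \<alpha> g \<circ> \<alpha> h)"

definition is_state :: "('a::cstar_algebra \<Rightarrow> complex) \<Rightarrow> bool" where
  "is_state \<phi> \<longleftrightarrow>
     (\<forall>A B. \<phi> (A + B) = \<phi> A + \<phi> B) \<and> (\<forall>c A. \<phi> (c *\<^sub>C A) = c * \<phi> A)
     \<and> (\<forall>A. \<phi> (star A * A) \<in> \<real>\<^sub>\<ge>\<^sub>0) \<and> \<phi> 1 = 1"

definition invariant_states ::
    "('g, 'm) monoid_scheme \<Rightarrow> ('g \<Rightarrow> 'a::cstar_algebra \<Rightarrow> 'a) \<Rightarrow> ('a \<Rightarrow> complex) set" where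
  "invariant_states G \<alpha> = {\<phi>. is_state \<phi> \<and> (\<forall>g\<in>carrier G. \<forall>A. \<phi> (\<alpha> g A) = \<phi> A)}"

definition star_representation ::
    "'h::complex_hilbert set \<Rightarrow> ('a::cstar_algebra \<Rightarrow> 'h \<Rightarrow> 'h) \<Rightarrow> bool" where
  "star_representation H \<pi> \<longleftrightarrow> range \<pi> \<subseteq> bounded_ops H
     \<and> (\<forall>x\<in>H. (\<forall>A B. \<pi> (A + B) x = \<pi> A x + \<pi> B x)
        \<and> (\<forall>c A. \<pi> (c *\<^sub>C A) x = c *\<^sub>C \<pi> A x)
        \<and> (\<forall>A B. \<pi> (A * B) x = \<pi> A (\<pi> B x))
        \<and> \<pi> 1 x = x
        \<and> (\<forall>A. \<forall>y\<in>H. cinner (\<pi> (star A) x) y = cinner x (\<pi> A y)))"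

definition gns_triple :: "('a::cstar_algebra \<Rightarrow> complex) \<Rightarrow>
    'h::complex_hilbert set \<Rightarrow> ('a \<Rightarrow> 'h \<Rightarrow> 'h) \<Rightarrow> 'h \<Rightarrow> bool" where
  "gns_triple \<phi> H \<pi> \<Omega> \<longleftrightarrow> csubspace H \<and> closed H \<and> star_representation H \<pi> \<and> \<Omega> \<in> H
     \<and> (\<forall>A. \<phi> A = cinner \<Omega> (\<pi> A \<Omega>)) \<and> closure (range (\<lambda>A. \<pi> A \<Omega>)) = H"

definition gns_quadruple ::
    "('g, 'm) monoid_scheme \<Rightarrow> ('g \<Rightarrow> 'a::cstar_algebra \<Rightarrow> 'a) \<Rightarrow> ('a \<Rightarrow> complex) \<Rightarrow>
     'h::complex_hilbert set \<Rightarrow> ('a \<Rightarrow> 'h \<Rightarrow> 'h) \<Rightarrow> ('g \<Rightarrow> 'h \<Rightarrow> 'h) \<Rightarrow> 'h \<Rightarrow> bool" where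
  "gns_quadruple G \<alpha> \<phi> H \<pi> U \<Omega> \<longleftrightarrow> gns_triple \<phi> H \<pi> \<Omega>
     \<and> (\<forall>g\<in>carrier G. U g \<in> unitary_ops H \<and> U g \<Omega> = \<Omega>)
     \<and> (\<forall>g\<in>carrier G. \<forall>h\<in>carrier G. \<forall>x\<in>H. U (g \<otimes>\<^bsub>G\<^esub> h) x = U g (U h x))
     \<and> (\<forall>g\<in>carrier G. \<forall>A. \<forall>x\<in>H. \<pi> (\<alpha> g A) x = U g (\<pi> A (inv_into H (U g) x)))"

definition fixed_proj ::
    "('g, 'm) monoid_scheme \<Rightarrow> 'h::complex_hilbert set \<Rightarrow> ('g \<Rightarrow> 'h \<Rightarrow> 'h) \<Rightarrow> 'h \<Rightarrow> 'h" where
  "fixed_proj G H U = orth_proj {\<xi> \<in> H. \<forall>g\<in>carrier G. U g \<xi> = \<xi>}"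

text \<open>The covariant GNS quadruple is unique only up to unitary equivalence, and the two notions
  below are invariant under it; so they quantify over all quadruples of \<open>\<phi>\<close>
  whose Hilbert space lies in \<open>'h\<close>. The type argument is needed because \<open>'h\<close> does not occur
  in \<open>G\<close> and \<open>\<alpha>\<close>. The notions themselves are the conjunction over all types \<open>'h\<close>, so
  a result should be stated with \<open>'h\<close> a type variable.\<close>

definition large_group_of_automorphisms ::
    "'h::complex_hilbert itself \<Rightarrow> ('g, 'm) monoid_scheme \<Rightarrow>
     ('g \<Rightarrow> 'a::cstar_algebra \<Rightarrow> 'a) \<Rightarrow> bool" where
  "large_group_of_automorphisms h G \<alpha> \<longleftrightarrow> cstar_action G \<alpha>
     \<and> (\<forall>A. star A = A \<longrightarrow>
        (\<forall>\<phi> \<in> invariant_states G \<alpha>. \<forall>(H :: 'h set) \<pi> U \<Omega>. gns_quadruple G \<alpha> \<phi> H \<pi> U \<Omega> \<longrightarrow>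
           weak_operator_topology H closure_of conv_ops {\<pi> (\<alpha> g A) | g. g \<in> carrier G}
             \<inter> commutant H (range \<pi>) \<noteq> {}))"

definition G_abelian ::
    "'h::complex_hilbert itself \<Rightarrow> ('g, 'm) monoid_scheme \<Rightarrow>
     ('g \<Rightarrow> 'a::cstar_algebra \<Rightarrow> 'a) \<Rightarrow> bool" where
  "G_abelian h G \<alpha> \<longleftrightarrow> cstar_action G \<alpha>
     \<and> (\<forall>\<phi> \<in> invariant_states G \<alpha>. \<forall>(H :: 'h set) \<pi> U \<Omega>. gns_quadruple G \<alpha> \<phi> H \<pi> U \<Omega> \<longrightarrow>
          (let E = fixed_proj G H U in
           \<forall>A B. \<forall>x\<in>H. (E \<circ> \<pi> A \<circ> E) ((E \<circ> \<pi> B \<circ> E) x) = (E \<circ> \<pi> B \<circ> E) ((E \<circ> \<pi> A \<circ> E) x)))"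


section \<open>The CAR algebra and finitary permutations\<close>

definition star_subalgebra :: "'a::cstar_algebra set \<Rightarrow> bool" where
  "star_subalgebra S \<longleftrightarrow> csubspace S \<and> 1 \<in> S
     \<and> (\<forall>x\<in>S. \<forall>y\<in>S. x * y \<in> S) \<and> (\<forall>x\<in>S. star x \<in> S)"

definition cstar_generated :: "'a::cstar_algebra set \<Rightarrow> 'a set" where
  "cstar_generated X = \<Inter>{S. star_subalgebra S \<and> closed S \<and> X \<subseteq> S}"

text \<open>The whole type \<open>'a\<close>, with annihilators \<open>a\<close>, is \<open>CAR(J)\<close>. The relations
  determine the \<open>C\<^sup>*\<close>-algebra they generate up to isomorphism.\<close>

definition is_CAR :: "'j set \<Rightarrow> ('j \<Rightarrow> 'a::cstar_algebra) \<Rightarrow> bool" where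
  "is_CAR J a \<longleftrightarrow>
     (\<forall>j\<in>J. \<forall>k\<in>J. star (a j) * a k + a k * star (a j) = (if j = k then 1 else 0)
        \<and> a j * a k + a k * a j = 0
        \<and> star (a j) * star (a k) + star (a k) * star (a j) = 0)
     \<and> cstar_generated (a ` J \<union> star ` a ` J) = UNIV"

definition finitary_perm_group :: "'j set \<Rightarrow> ('j \<Rightarrow> 'j) monoid" where
  "finitary_perm_group J =
     \<lparr>carrier = {g. g permutes J \<and> finite {j. g j \<noteq> j}}, mult = (\<circ>), one = id\<rparr>"

end

theory Submission
  imports Defs "HOL-Computational_Algebra.Formal_Power_Series"
begin

text \<open>Fix a covariant GNS representation of an invariant state and let \<open>E\<close> project onto the invariant
  vectors. Any finite set of indices can be moved by \<open>\<^bold>P\<^sub>J\<close> away from any other one, and displaced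
  even elements commute with local ones. Displaced copies \<open>X\<^sub>1, \<dots>, X\<^sub>n\<close> of an odd element satisfy
  \<open>{X\<^sub>i\<^sup>*, X\<^sub>j} = 0\<close> for \<open>i \<noteq> j\<close>, so that with \<open>S = X\<^sub>1 + \<dots> + X\<^sub>n\<close> the operator \<open>S\<^sup>*S + SS\<^sup>*\<close> has norm
  at most \<open>2n \<parallel>X\<parallel>\<^sup>2\<close> and the average \<open>S/n\<close> tends to \<open>0\<close> in norm. Hence every \<open>A\<close> has averages over
  its orbit whose commutators with finitely many given elements are as small as desired.
  Combined with the mean ergodic theorem, which gives averages \<open>X\<close> with \<open>\<pi>(X)\<Omega>\<close> close to
  \<open>E \<pi>(A) \<Omega>\<close>, this makes the map \<open>\<pi>(B)\<Omega> \<mapsto> \<pi>(B) E \<pi>(A) \<Omega>\<close> extend to a bounded operator in the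
  commutant that is a strong limit of averages of \<open>A\<close>; the same two facts make
  \<open>E \<pi>(A) E\<close> and \<open>E \<pi>(B) E\<close> commute.\<close>

section \<open>Hilbert spaces and \<open>C\<^sup>*\<close>-algebras\<close>

text \<open>Removes an error of size \<open>e\<close> times a fixed constant; dividing by
  \<open>c + 1\<close> instead of \<open>c\<close> covers the case \<open>c = 0\<close>.\<close>

lemma le_if_le_add_mult:
  fixes a b c :: real
  assumes "\<And>e. e > 0 \<Longrightarrow> a \<le> b + e * c" and "c \<ge> 0"
  shows "a \<le> b"
proof (rule field_le_epsilon)
  fix e :: real assume "e > 0"
  then have "a \<le> b + e / (c + 1) * c" using assms(2) by (intro assms(1)) simp
  also have "\<dots> \<le> b + e" using \<open>e > 0\<close> assms(2) by (simp add: field_simps)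
  finally show "a \<le> b + e" .
qed

section \<open>Complex subspaces and the complex inner product\<close>

lemma scaleC_minus_one: "(-1) *\<^sub>C x = - (x::'a::complex_vector)"
  using scaleR_scaleC[of "-1" x] by simp

lemma scaleC_zero_right: "c *\<^sub>C 0 = (0::'a::complex_vector)"
  using scaleC_add_right[of c 0 0] by simp

lemma scaleC_diff_right: "c *\<^sub>C (x - y) = c *\<^sub>C x - c *\<^sub>C (y::'a::complex_vector)"
  using scaleC_add_right[of c "x - y" y] by (simp add: algebra_simps)

lemma csubspace_minus: "csubspace S \<Longrightarrow> x \<in> S \<Longrightarrow> - x \<in> S"
  unfolding csubspace_def by (metis scaleC_minus_one)

lemma csubspace_add: "csubspace S \<Longrightarrow> x \<in> S \<Longrightarrow> y \<in> S \<Longrightarrow> x + y \<in> S"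
  unfolding csubspace_def by blast

lemma csubspace_diff: "csubspace S \<Longrightarrow> x \<in> S \<Longrightarrow> y \<in> S \<Longrightarrow> x - y \<in> S"
  using csubspace_add[of S x "- y"] csubspace_minus[of S y] by simp

lemma csubspace_scaleC: "csubspace S \<Longrightarrow> x \<in> S \<Longrightarrow> c *\<^sub>C x \<in> S"
  unfolding csubspace_def by blast

lemma csubspace_scaleR: "csubspace S \<Longrightarrow> x \<in> S \<Longrightarrow> c *\<^sub>R x \<in> S"
  by (simp add: csubspace_scaleC scaleR_scaleC)

lemma csubspace_zero: "csubspace S \<Longrightarrow> 0 \<in> S"
  unfolding csubspace_def by blast

lemma csubspace_subspace: "csubspace S \<Longrightarrow> subspace S"
  by (simp add: subspace_def csubspace_add csubspace_scaleR csubspace_zero)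

lemma csubspace_convex: "csubspace S \<Longrightarrow> convex S"
  by (simp add: csubspace_subspace subspace_imp_convex)

lemma cinner_scaleC_left: "cinner (c *\<^sub>C x) z = cnj c * cinner x (z::'h::complex_hilbert)"
  by (subst (1 2) cinner_commute) (simp add: cinner_scaleC_right)

lemma cinner_minus_right: "cinner x (- y) = - cinner x (y::'h::complex_hilbert)"
  using cinner_scaleC_right[of x "-1" y] by (simp add: scaleC_minus_one)

lemma cinner_diff_right: "cinner x (y - z) = cinner x y - cinner x (z::'h::complex_hilbert)"
  using cinner_add_right[of x y "- z"] by (simp add: cinner_minus_right)

lemma norm_scaleC_hilbert: "norm (c *\<^sub>C x) = cmod c * norm (x::'h::complex_hilbert)"
proof -
  have "(norm (c *\<^sub>C x))\<^sup>2 = Re (cinner (c *\<^sub>C x) (c *\<^sub>C x))"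
    by (simp add: power2_norm_eq_inner inner_eq_Re_cinner)
  also have "\<dots> = Re ((c * cnj c) * cinner x x)"
    by (simp add: cinner_scaleC_left cinner_scaleC_right mult.assoc mult.left_commute)
  also have "c * cnj c = complex_of_real ((cmod c)\<^sup>2)"
    by (metis complex_norm_square)
  also have "Re (complex_of_real ((cmod c)\<^sup>2) * cinner x x) = (cmod c)\<^sup>2 * (norm x)\<^sup>2"
    by (simp add: power2_norm_eq_inner inner_eq_Re_cinner del: of_real_power)
  finally show ?thesis
    by (metis norm_ge_zero power2_eq_iff_nonneg power_mult_distrib mult_nonneg_nonneg)
qed

text \<open>Multiplying \<open>y\<close> by the unimodular number that turns
  \<open>cinner x y\<close> into its modulus reduces the complex Cauchy--Schwarz inequality to the
  real one.\<close>

lemma cmod_cinner_le: "cmod (cinner x y) \<le> norm x * norm (y::'h::complex_hilbert)"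
proof (cases "cinner x y = 0")
  case False
  define c where "c = cnj (sgn (cinner x y))"
  have c: "cmod c = 1" using False by (simp add: c_def norm_sgn)
  have "c * cinner x y = complex_of_real (cmod (cinner x y))"
  proof -
    have "c * cinner x y = (cinner x y * cnj (cinner x y)) / complex_of_real (cmod (cinner x y))"
      by (simp add: c_def sgn_eq mult.commute)
    also have "\<dots> = complex_of_real (cmod (cinner x y))"
      using False by (simp add: complex_norm_square[symmetric] power2_eq_square)
    finally show ?thesis .
  qed
  then have "cmod (cinner x y) = Re (cinner x (c *\<^sub>C y))"
    by (simp add: cinner_scaleC_right)
  also have "\<dots> = inner x (c *\<^sub>C y)" by (simp add: inner_eq_Re_cinner)
  also have "\<dots> \<le> norm x * norm (c *\<^sub>C y)" by (rule norm_cauchy_schwarz)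
  finally show ?thesis by (simp add: norm_scaleC_hilbert c)
qed simp

lemma bounded_linear_cinner_right: "bounded_linear (cinner (x::'h::complex_hilbert))"
proof (rule bounded_linear_intro[where K = "norm x"])
  show "cinner x (r *\<^sub>R y) = r *\<^sub>R cinner x y" for r y
    by (simp add: scaleR_scaleC[where 'a = 'h] cinner_scaleC_right scaleR_conv_of_real)
  show "norm (cinner x y) \<le> norm y * norm x" for y
    using cmod_cinner_le[of x y] by (simp add: mult.commute)
qed (rule cinner_add_right)

lemma cinner_zero_right: "cinner x 0 = (0::complex)" for x :: "'h::complex_hilbert"
  using bounded_linear_cinner_right bounded_linear.linear linear_0 by blast

lemma power2_norm_cinner: "complex_of_real ((norm (x::'h::complex_hilbert))\<^sup>2) = cinner x x"
proof (rule complex_eqI)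
  show "Re (complex_of_real ((norm x)\<^sup>2)) = Re (cinner x x)"
    by (simp only: Re_complex_of_real power2_norm_eq_inner inner_eq_Re_cinner)
  have "Im (cinner x x) = - Im (cinner x x)"
    by (subst cinner_commute) simp
  then show "Im (complex_of_real ((norm x)\<^sup>2)) = Im (cinner x x)" by simp
qed

section \<open>The involution and square roots of positive elements near 1\<close>

lemma star_zero: "star (0::'a::cstar_algebra) = 0"
  using star_add[of 0 "0::'a"] by simp

lemma star_one: "star (1::'a::cstar_algebra) = 1"
  by (metis mult.left_neutral mult.right_neutral star_mult star_star)

lemma star_scaleR: "star (r *\<^sub>R x) = r *\<^sub>R star (x::'a::cstar_algebra)"
  by (simp add: scaleR_scaleC star_scaleC)

lemma star_minus: "star (- x) = - star (x::'a::cstar_algebra)"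
  using star_scaleR[of "-1" x] by simp

text \<open>The C*-identity and submultiplicativity give one inequality; applied to
  \<open>star x\<close> it gives the other.\<close>

lemma norm_star: "norm (star x) = norm (x::'a::cstar_algebra)"
proof -
  have le: "norm y \<le> norm (star y)" for y :: 'a
  proof (cases "y = 0")
    case False
    have "norm y * norm y \<le> norm (star y) * norm y"
      by (metis cstar_identity norm_mult_ineq power2_eq_square)
    then show ?thesis using False by simp
  qed simp
  show ?thesis using le[of x] le[of "star x"] by (simp add: star_star)
qed

lemma bounded_linear_star: "bounded_linear (star :: 'a::cstar_algebra \<Rightarrow> 'a)"
  by (rule bounded_linear_intro[where K = 1]) (simp_all add: star_add star_scaleR norm_star)

lemma star_power: "star (x ^ n) = star (x::'a::cstar_algebra) ^ n"
  by (induction n) (simp_all add: star_one star_mult power_commutes)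

text \<open>The binomial series with exponent 1 stops after the linear term; this collapses the
  square of the series with exponent 1/2.\<close>

lemma one_gchoose: "(1::real) gchoose n = (if n \<le> 1 then 1 else 0)"
proof -
  have "(1::real) gchoose n = of_nat (1 choose n)"
    using binomial_gbinomial[of 1 n, where 'a = real] by simp
  then show ?thesis by (cases n) (auto simp: binomial_eq_0)
qed

text \<open>The square root is the binomial series of \<open>(1 - C)\<^sup>1\<^sup>/\<^sup>2\<close>.\<close>

lemma one_minus_selfadjoint_square:
  fixes C :: "'a::cstar_algebra"
  assumes "star C = C" and "norm C < 1"
  obtains D where "star D = D" and "D * D = 1 - C"
proof
  define f where "f n = ((1/2::real) gchoose n) *\<^sub>R (- C) ^ n" for n
  \<comment> \<open>The radius of convergence is at least 1, so \<open>norm C < 1\<close> gives the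
    absolute convergence that the Cauchy product needs.\<close>
  have "summable (\<lambda>n. norm (((1/2::real) gchoose n) * norm C ^ n))"
  proof (rule abs_summable_in_conv_radius)
    have "conv_radius (\<lambda>n. (1/2::real) gchoose n) \<ge> 1"
      by (subst conv_radius_gchoose) simp
    moreover have "ereal (norm (norm C)) < 1"
      using assms(2) by simp
    ultimately show "ereal (norm (norm C)) < conv_radius (\<lambda>n. (1/2::real) gchoose n)"
      by order
  qed
  then have sum_norm: "summable (\<lambda>n. norm (f n))"
  proof (rule summable_comparison_test'[where N = 0])
    fix n :: nat
    assume "n \<ge> 0"
    have "norm ((- C) ^ n) \<le> norm C ^ n" using norm_power_ineq[of "- C" n] by simp
    then show "norm (norm (f n)) \<le> norm ((1/2 gchoose n) * norm C ^ n)"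
      by (simp add: f_def abs_mult mult_left_mono)
  qed
  then have sum_f: "summable f" by (rule summable_norm_cancel)
  show "star (suminf f) = suminf f"
  proof -
    have "star (suminf f) = (\<Sum>n. star (f n))"
      using bounded_linear.suminf[OF bounded_linear_star sum_f] by simp
    also have "(\<lambda>n. star (f n)) = f"
      by (simp add: fun_eq_iff f_def star_scaleR star_power star_minus assms)
    finally show ?thesis .
  qed
  have "suminf f * suminf f = (\<Sum>k. \<Sum>i\<le>k. f i * f (k - i))"
    by (rule Cauchy_product[OF sum_norm sum_norm])
  \<comment> \<open>Vandermonde's identity adds the exponents: 1/2 + 1/2 = 1.\<close>
  also have "\<dots> = (\<Sum>k. ((1::real) gchoose k) *\<^sub>R (- C) ^ k)"
  proof (rule suminf_cong)
    fix k :: nat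
    have "(\<Sum>i\<le>k. f i * f (k - i)) =
        (\<Sum>i\<le>k. (((1/2::real) gchoose i) * (1/2 gchoose (k - i))) *\<^sub>R (- C) ^ k)"
      by (rule sum.cong) (auto simp: f_def power_add[symmetric])
    also have "\<dots> = (\<Sum>i\<in>{0..k}. ((1/2::real) gchoose i) * (1/2 gchoose (k - i))) *\<^sub>R (- C) ^ k"
      by (simp add: scaleR_left.sum atMost_atLeast0)
    finally show "(\<Sum>i\<le>k. f i * f (k - i)) = ((1::real) gchoose k) *\<^sub>R (- C) ^ k"
      by (simp add: gbinomial_Vandermonde)
  qed
  also have "\<dots> = (\<Sum>k\<in>{0, 1}. ((1::real) gchoose k) *\<^sub>R (- C) ^ k)"
    by (rule suminf_finite) (auto simp: one_gchoose)
  finally show "suminf f * suminf f = 1 - C"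
    by (simp add: one_gchoose)
qed

text \<open>By the parallelogram identity two near-minimisers of the norm are close to each other.
  The closed sets of near-minimisers therefore shrink to a point, by completeness, and the same
  estimate gives uniqueness.\<close>

lemma closed_convex_min_norm:
  fixes K :: "'h::{real_inner,banach} set"
  assumes "closed K" and "convex K" and "K \<noteq> {}"
  obtains p where "p \<in> K" and "\<And>x. x \<in> K \<Longrightarrow> norm x \<le> norm p \<Longrightarrow> x = p"
proof -
  define D where "D = Inf ((\<lambda>x. (norm x)\<^sup>2) ` K)"
  have D_le: "D \<le> (norm x)\<^sup>2" if "x \<in> K" for x
    unfolding D_def by (rule cInf_lower) (use that in \<open>auto intro!: bdd_belowI[of _ 0]\<close>)
  have par: "(dist x y)\<^sup>2 \<le> 4 * e"
    if "x \<in> K" "y \<in> K" "(norm x)\<^sup>2 \<le> D + e" "(norm y)\<^sup>2 \<le> D + e" for x y e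
  proof -
    \<comment> \<open>The midpoint stays in \<open>K\<close>, so its squared norm is at least
      \<open>D\<close>; the parallelogram identity converts this into a bound on the
      distance.\<close>
    have "(1/2) *\<^sub>R x + (1/2) *\<^sub>R y \<in> K"
      using assms(2) that by (intro convexD) auto
    then have "4 * D \<le> 4 * (norm ((1/2) *\<^sub>R x + (1/2) *\<^sub>R y))\<^sup>2" using D_le by simp
    also have "\<dots> = (norm (x + y))\<^sup>2"
      by (simp add: power2_norm_eq_inner inner_add_left inner_add_right inner_commute)
    finally show ?thesis
      using that by (simp add: dist_norm power2_norm_eq_inner inner_add_left inner_add_right
          inner_diff_left inner_diff_right inner_commute)
  qed
  define S where "S n = K \<inter> {x. (norm x)\<^sup>2 \<le> D + inverse (real (Suc n))}" for n
  obtain p where p: "\<And>n. p \<in> S n"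
  proof (rule decreasing_closed_nest[of S])
    show "closed (S n)" for n
      unfolding S_def by (intro closed_Int assms closed_Collect_le continuous_intros)
    show "S n \<noteq> {}" for n
    proof -
      have "\<exists>y\<in>(\<lambda>x. (norm x)\<^sup>2) ` K. y < D + inverse (real (Suc n))"
        using assms(3) by (subst cInf_less_iff[symmetric])
          (auto simp: D_def[symmetric] intro!: bdd_belowI[of _ 0])
      then show ?thesis by (auto simp: S_def intro: less_imp_le)
    qed
    show "S n \<subseteq> S m" if "m \<le> n" for m n
    proof -
      have "inverse (real (Suc n)) \<le> inverse (real (Suc m))"
        using that by (intro le_imp_inverse_le) auto
      then have "D + inverse (real (Suc n)) \<le> D + inverse (real (Suc m))" by simp
      then show ?thesis unfolding S_def using order_trans by blast
    qed
    fix \<epsilon> :: real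
    assume "\<epsilon> > 0"
    then obtain n where n: "inverse (real (Suc n)) < \<epsilon>\<^sup>2 / 4"
      using reals_Archimedean[of "\<epsilon>\<^sup>2 / 4"] by auto
    have "dist x y < \<epsilon>" if "x \<in> S n" "y \<in> S n" for x y
    proof -
      have "(dist x y)\<^sup>2 \<le> 4 * inverse (real (Suc n))" using that by (intro par) (auto simp: S_def)
      with n have "(dist x y)\<^sup>2 < \<epsilon>\<^sup>2" by linarith
      then show ?thesis using \<open>\<epsilon> > 0\<close> power_less_imp_less_base by fastforce
    qed
    then show "\<exists>n. \<forall>x\<in>S n. \<forall>y\<in>S n. dist x y < \<epsilon>" by blast
  qed blast
  have pK: "p \<in> K" using p[of 0] by (simp add: S_def)
  have pD: "(norm p)\<^sup>2 \<le> D"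
  proof (rule field_le_epsilon)
    fix e :: real assume "e > 0"
    then obtain n where "inverse (real (Suc n)) < e" using reals_Archimedean by blast
    then show "(norm p)\<^sup>2 \<le> D + e" using p[of n] by (simp add: S_def)
  qed
  show ?thesis
  proof (rule that[OF pK])
    fix x assume x: "x \<in> K" "norm x \<le> norm p"
    have "(norm x)\<^sup>2 \<le> (norm p)\<^sup>2" using x(2) by (rule power_mono) simp
    with pD have "(norm x)\<^sup>2 \<le> D" by linarith
    \<comment> \<open>Both vectors attain the infimum, so the estimate applies with
      \<open>e = 0\<close>.\<close>
    then have "(dist x p)\<^sup>2 \<le> 4 * 0" using x pK pD by (intro par) auto
    then show "x = p" by simp
  qed
qed

text \<open>\<open>conv_ops\<close> attaches weights to operators, not to indices; different indices
  may give the same operator, so \<open>t\<close> adds the weights along each fibre of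
  \<open>T\<close>.\<close>

lemma convex_combination_in_conv_ops:
  fixes u :: "'i \<Rightarrow> real" and T :: "'i \<Rightarrow> 'h::complex_hilbert \<Rightarrow> 'h"
  assumes "finite I" and "\<And>i. i \<in> I \<Longrightarrow> T i \<in> S" and "\<And>i. i \<in> I \<Longrightarrow> 0 \<le> u i" and "sum u I = 1"
  shows "(\<lambda>x. \<Sum>i\<in>I. u i *\<^sub>R T i x) \<in> conv_ops S"
proof -
  define t where "t R = sum u {i\<in>I. T i = R}" for R
  have eq: "(\<Sum>R\<in>T ` I. t R *\<^sub>R R x) = (\<Sum>i\<in>I. u i *\<^sub>R T i x)" for x
  proof -
    have "(\<Sum>i\<in>I. u i *\<^sub>R T i x) = (\<Sum>R\<in>T ` I. \<Sum>i\<in>{i\<in>I. T i = R}. u i *\<^sub>R T i x)"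
      by (rule sum.image_gen[OF assms(1)])
    also have "\<dots> = (\<Sum>R\<in>T ` I. t R *\<^sub>R R x)"
      by (rule sum.cong) (auto simp: t_def scaleR_left.sum)
    finally show ?thesis by simp
  qed
  have "sum t (T ` I) = 1"
    unfolding t_def by (subst sum.image_gen[OF assms(1), symmetric]) (rule assms)
  moreover have "\<forall>R\<in>T ` I. 0 \<le> t R" using assms(3) by (auto simp: t_def intro!: sum_nonneg)
  moreover have "T ` I \<subseteq> S" "finite (T ` I)" using assms by auto
  ultimately show ?thesis
    unfolding conv_ops_def eq[symmetric] by blast
qed

text \<open>Weak neighbourhoods contain strong ones, so strong approximation on finitely many
  vectors will suffice for the weak closure. Induction over the generation of the topology from its
  subbase; Cauchy--Schwarz settles subbasic sets.\<close>

lemma weak_operator_nhd: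
  assumes "openin (weak_operator_topology H) W" and "T \<in> W"
  shows "\<exists>Y e. finite Y \<and> Y \<subseteq> H \<and> e > 0 \<and>
    (\<forall>S\<in>bounded_ops H. (\<forall>y\<in>Y. norm (S y - T y) < e) \<longrightarrow> S \<in> W)"
proof -
  have "generate_topology_on
      {{T \<in> bounded_ops H. cinner x (T y) \<in> V} | x y V. x \<in> H \<and> y \<in> H \<and> open V} W"
    using assms(1) by (simp add: weak_operator_topology_def openin_topology_generated_by_iff)
  then show ?thesis using assms(2)
  proof (induction rule: generate_topology_on.induct)
    case (Int W1 W2)
    then have "T \<in> W1" "T \<in> W2" by auto
    from Int.IH(1)[OF this(1)] obtain Y1 e1 where
      "finite Y1" "Y1 \<subseteq> H" "e1 > 0"
      "\<forall>S\<in>bounded_ops H. (\<forall>y\<in>Y1. norm (S y - T y) < e1) \<longrightarrow> S \<in> W1" by blast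
    moreover from Int.IH(2)[OF \<open>T \<in> W2\<close>] obtain Y2 e2 where
      "finite Y2" "Y2 \<subseteq> H" "e2 > 0"
      "\<forall>S\<in>bounded_ops H. (\<forall>y\<in>Y2. norm (S y - T y) < e2) \<longrightarrow> S \<in> W2" by blast
    ultimately show ?case
      by (intro exI[of _ "Y1 \<union> Y2"] exI[of _ "min e1 e2"]) auto
  next
    case (UN K)
    then obtain k where k: "k \<in> K" "T \<in> k" by blast
    from UN.IH[OF this] obtain Y e where "finite Y" "Y \<subseteq> H" "e > 0"
      "\<forall>S\<in>bounded_ops H. (\<forall>y\<in>Y. norm (S y - T y) < e) \<longrightarrow> S \<in> k" by blast
    then show ?case
      using k(1) by (intro exI[of _ Y] exI[of _ e]) auto
  next
    case (Basis s)
    then obtain x y V where s: "s = {T \<in> bounded_ops H. cinner x (T y) \<in> V}"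
      and xy: "x \<in> H" "y \<in> H" "open V" by blast
    have "cinner x (T y) \<in> V" using Basis s by blast
    then obtain d where d: "d > 0" "\<And>z. dist z (cinner x (T y)) < d \<Longrightarrow> z \<in> V"
      using \<open>open V\<close> open_dist by metis
    \<comment> \<open>The summand 1 keeps the divisor positive when \<open>x = 0\<close>.\<close>
    have "S \<in> s" if S: "S \<in> bounded_ops H" "norm (S y - T y) < d / (norm x + 1)" for S
    proof -
      have "dist (cinner x (S y)) (cinner x (T y)) \<le> norm x * norm (S y - T y)"
        using cmod_cinner_le[of x "S y - T y"] by (simp add: dist_norm cinner_diff_right)
      also have "\<dots> \<le> (norm x + 1) * norm (S y - T y)" by (simp add: mult_right_mono)
      also have "\<dots> < d"
        using S(2) norm_ge_zero[of x] by (simp add: pos_less_divide_eq mult.commute)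
      finally show ?thesis using d S s by simp
    qed
    then show ?case
      using xy d norm_ge_zero[of x]
      by (intro exI[of _ "{y}"] exI[of _ "d / (norm x + 1)"]) (auto intro!: divide_pos_pos add_nonneg_pos)
  qed simp
qed

section \<open>Covariant representations\<close>

text \<open>The data of \<open>gns_quadruple\<close> apart from the state and \<Omega>, so that the
  arguments below can be run with any invariant vector.\<close>

locale covariant_representation =
  fixes G :: "('g, 'm) monoid_scheme"
    and \<alpha> :: "'g \<Rightarrow> 'a::cstar_algebra \<Rightarrow> 'a"
    and H :: "'h::complex_hilbert set"
    and \<pi> :: "'a \<Rightarrow> 'h \<Rightarrow> 'h"
    and U :: "'g \<Rightarrow> 'h \<Rightarrow> 'h"
  assumes action: "cstar_action G \<alpha>"
    and csubspace_H: "csubspace H"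
    and closed_H: "closed H"
    and rep: "star_representation H \<pi>"
    and unitary: "g \<in> carrier G \<Longrightarrow> U g \<in> unitary_ops H"
    and U_mult: "\<lbrakk>g \<in> carrier G; h \<in> carrier G; x \<in> H\<rbrakk> \<Longrightarrow> U (g \<otimes>\<^bsub>G\<^esub> h) x = U g (U h x)"
    and pi_alpha: "\<lbrakk>g \<in> carrier G; x \<in> H\<rbrakk> \<Longrightarrow> \<pi> (\<alpha> g A) x = U g (\<pi> A (inv_into H (U g) x))"
begin

section \<open>Algebraic rules on \<open>H\<close>, and contractivity of the representation\<close>

lemmas H_add = csubspace_add[OF csubspace_H]
  and H_diff = csubspace_diff[OF csubspace_H]
  and H_scaleC = csubspace_scaleC[OF csubspace_H]
  and H_scaleR = csubspace_scaleR[OF csubspace_H]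
  and H_zero = csubspace_zero[OF csubspace_H]

lemma group: "group G"
  using action by (simp add: cstar_action_def)

lemma one_in: "\<one>\<^bsub>G\<^esub> \<in> carrier G"
  using group by (simp add: group.is_monoid monoid.one_closed)

lemma mult_in: "g \<in> carrier G \<Longrightarrow> h \<in> carrier G \<Longrightarrow> g \<otimes>\<^bsub>G\<^esub> h \<in> carrier G"
  using group by (simp add: group.is_monoid monoid.m_closed)

lemma alpha_mult_group: "g \<in> carrier G \<Longrightarrow> h \<in> carrier G \<Longrightarrow> \<alpha> (g \<otimes>\<^bsub>G\<^esub> h) A = \<alpha> g (\<alpha> h A)"
  using action by (simp add: cstar_action_def)

lemma star_automorphism: "g \<in> carrier G \<Longrightarrow> star_automorphism (\<alpha> g)"
  using action by (simp add: cstar_action_def)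

lemma alpha_add: "g \<in> carrier G \<Longrightarrow> \<alpha> g (A + B) = \<alpha> g A + \<alpha> g B"
  and alpha_scaleC: "g \<in> carrier G \<Longrightarrow> \<alpha> g (c *\<^sub>C A) = c *\<^sub>C \<alpha> g A"
  and alpha_star: "g \<in> carrier G \<Longrightarrow> \<alpha> g (star A) = star (\<alpha> g A)"
  using star_automorphism[of g] by (simp_all add: star_automorphism_def)

lemma alpha_scaleR: "g \<in> carrier G \<Longrightarrow> \<alpha> g (r *\<^sub>R A) = r *\<^sub>R \<alpha> g A"
  by (simp add: scaleR_scaleC alpha_scaleC)

lemma linear_alpha: "g \<in> carrier G \<Longrightarrow> linear (\<alpha> g)"
  by (intro linearI alpha_add alpha_scaleR)

lemma pi_bounded_ops: "\<pi> A \<in> bounded_ops H"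
  using rep by (auto simp: star_representation_def)

lemma pi_in: "x \<in> H \<Longrightarrow> \<pi> A x \<in> H"
  and pi_vec_add: "x \<in> H \<Longrightarrow> y \<in> H \<Longrightarrow> \<pi> A (x + y) = \<pi> A x + \<pi> A y"
  using pi_bounded_ops[of A] by (simp_all add: bounded_ops_def)

lemma pi_add: "x \<in> H \<Longrightarrow> \<pi> (A + B) x = \<pi> A x + \<pi> B x"
  and pi_scaleC: "x \<in> H \<Longrightarrow> \<pi> (c *\<^sub>C A) x = c *\<^sub>C \<pi> A x"
  and pi_mult: "x \<in> H \<Longrightarrow> \<pi> (A * B) x = \<pi> A (\<pi> B x)"
  and pi_one: "x \<in> H \<Longrightarrow> \<pi> 1 x = x"
  and pi_star: "x \<in> H \<Longrightarrow> y \<in> H \<Longrightarrow> cinner (\<pi> (star A) x) y = cinner x (\<pi> A y)"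
  using rep by (simp_all add: star_representation_def)

lemma pi_scaleR: "x \<in> H \<Longrightarrow> \<pi> (r *\<^sub>R A) x = r *\<^sub>R \<pi> A x"
  by (simp add: scaleR_scaleC pi_scaleC)

lemma linear_pi: "x \<in> H \<Longrightarrow> linear (\<lambda>A. \<pi> A x)"
  by (intro linearI pi_add pi_scaleR)

lemmas pi_diff = linear_diff[OF linear_pi]
  and pi_sum = linear_sum[OF linear_pi]

lemma pi_vec_diff: "x \<in> H \<Longrightarrow> y \<in> H \<Longrightarrow> \<pi> A (x - y) = \<pi> A x - \<pi> A y"
  using pi_vec_add[of "x - y" y A] by (simp add: H_diff)

lemma U_in: "g \<in> carrier G \<Longrightarrow> x \<in> H \<Longrightarrow> U g x \<in> H"
  and U_add: "g \<in> carrier G \<Longrightarrow> x \<in> H \<Longrightarrow> y \<in> H \<Longrightarrow> U g (x + y) = U g x + U g y"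
  and U_scaleC: "g \<in> carrier G \<Longrightarrow> x \<in> H \<Longrightarrow> U g (c *\<^sub>C x) = c *\<^sub>C U g x"
  and U_surj: "g \<in> carrier G \<Longrightarrow> U g ` H = H"
  and U_cinner: "g \<in> carrier G \<Longrightarrow> x \<in> H \<Longrightarrow> y \<in> H \<Longrightarrow> cinner (U g x) (U g y) = cinner x y"
  using unitary[of g] by (simp_all add: unitary_ops_def bounded_ops_def)

lemma U_scaleR: "g \<in> carrier G \<Longrightarrow> x \<in> H \<Longrightarrow> U g (r *\<^sub>R x) = r *\<^sub>R U g x"
  by (simp add: scaleR_scaleC U_scaleC)

lemma U_diff: "g \<in> carrier G \<Longrightarrow> x \<in> H \<Longrightarrow> y \<in> H \<Longrightarrow> U g (x - y) = U g x - U g y"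
  using U_add[of g "x - y" y] by (simp add: H_diff)

lemma U_norm: "g \<in> carrier G \<Longrightarrow> x \<in> H \<Longrightarrow> norm (U g x) = norm x"
  by (simp add: norm_eq_sqrt_inner inner_eq_Re_cinner U_cinner)

lemma U_inj: "g \<in> carrier G \<Longrightarrow> inj_on (U g) H"
proof (rule inj_onI)
  fix x y assume *: "g \<in> carrier G" "x \<in> H" "y \<in> H" "U g x = U g y"
  then have "norm (x - y) = norm (U g x - U g y)"
    by (metis H_diff U_diff U_norm)
  then show "x = y" using * by simp
qed

lemma covariance: "g \<in> carrier G \<Longrightarrow> x \<in> H \<Longrightarrow> \<pi> (\<alpha> g A) (U g x) = U g (\<pi> A x)"
  by (simp add: pi_alpha U_in U_inj)

text \<open>Membership in \<open>bounded_ops\<close> only gives some bound. For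
  \<open>r > norm A\<close> and \<open>B = A / r\<close> the positive element
  \<open>1 - star B * B\<close> is a square \<open>D * D\<close> with \<open>D\<close> selfadjoint,
  so \<open>norm x\<close> squared minus \<open>norm (\<pi> B x)\<close> squared equals
  \<open>norm (\<pi> D x)\<close> squared and is nonnegative. Then \<open>r\<close> tends to
  \<open>norm A\<close>.\<close>

lemma norm_pi_le:
  assumes "x \<in> H"
  shows "norm (\<pi> A x) \<le> norm A * norm x"
proof -
  have "norm (\<pi> A x) \<le> r * norm x" if r: "r > norm A" for r
  proof -
    have r0: "r > 0" using r norm_ge_zero[of A] by linarith
    define B where "B = (1 / r) *\<^sub>R A"
    have "norm B < 1" using r r0 by (simp add: B_def field_simps)
    then have "norm (star B * B) < 1"
      by (simp add: cstar_identity abs_square_less_1)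
    moreover have "star (star B * B) = star B * B" by (simp add: star_mult star_star)
    ultimately obtain D where D: "star D = D" "D * D = 1 - star B * B"
      using one_minus_selfadjoint_square by blast
    have "complex_of_real ((norm (\<pi> D x))\<^sup>2) = cinner x (\<pi> (D * D) x)"
      using pi_star[of x "\<pi> D x" D] assms
      by (simp only: power2_norm_cinner D(1) pi_in pi_mult)
    also have "\<dots> = cinner x x - cinner x (\<pi> (star B) (\<pi> B x))"
      using assms by (simp add: D pi_diff pi_one pi_mult cinner_diff_right)
    also have "cinner x (\<pi> (star B) (\<pi> B x)) = cinner (\<pi> B x) (\<pi> B x)"
      using pi_star[of x "\<pi> B x" "star B"] assms by (simp add: pi_in star_star)
    finally have "complex_of_real ((norm (\<pi> D x))\<^sup>2) =
        complex_of_real ((norm x)\<^sup>2 - (norm (\<pi> B x))\<^sup>2)"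
      by (simp only: power2_norm_cinner of_real_diff)
    then have "(norm (\<pi> D x))\<^sup>2 = (norm x)\<^sup>2 - (norm (\<pi> B x))\<^sup>2"
      using of_real_eq_iff by blast
    then have "(norm (\<pi> B x))\<^sup>2 \<le> (norm x)\<^sup>2"
      using zero_le_power2[of "norm (\<pi> D x)"] by linarith
    then have "norm (\<pi> B x) \<le> norm x" using norm_ge_zero by (rule power2_le_imp_le)
    then show ?thesis using assms r0 by (simp add: B_def pi_scaleR field_simps)
  qed
  then have "norm (\<pi> A x) \<le> norm A * norm x + e * norm x" if "e > 0" for e
    using that by (metis distrib_right less_add_same_cancel1)
  then show ?thesis by (rule le_if_le_add_mult) simp_all
qed

text \<open>Covariance replaces the automorphism by the unitary \<open>U g\<close>, which preserves
  norms.\<close>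

lemma norm_pi_alpha_le:
  assumes g: "g \<in> carrier G" and x: "x \<in> H"
  shows "norm (\<pi> (\<alpha> g A) x) \<le> norm A * norm x"
proof -
  obtain y where y: "y \<in> H" "x = U g y" using U_surj[OF g] x by blast
  then show ?thesis
    using norm_pi_le[OF y(1), of A] by (simp add: covariance U_norm pi_in g)
qed

text \<open>Averages are formed in the algebra, before applying \<pi>, so that they can be
  multiplied and averaged again. The hull is not closed.\<close>

definition orbit_hull :: "'a \<Rightarrow> 'a set" where
  "orbit_hull A = convex hull {\<alpha> g A | g. g \<in> carrier G}"

lemma alpha_in_orbit_hull: "g \<in> carrier G \<Longrightarrow> \<alpha> g A \<in> orbit_hull A"
  unfolding orbit_hull_def by (rule hull_inc) auto

lemma convex_orbit_hull: "convex (orbit_hull A)"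
  by (simp add: orbit_hull_def)

text \<open>The induction principle for averages: a convex property is checked on the orbit
  only.\<close>

lemma orbit_hull_subset:
  assumes "\<And>g. g \<in> carrier G \<Longrightarrow> \<alpha> g A \<in> K" and "convex K"
  shows "orbit_hull A \<subseteq> K"
  unfolding orbit_hull_def by (rule hull_minimal) (use assms in auto)

lemma alpha_orbit_hull:
  assumes "g \<in> carrier G" and "X \<in> orbit_hull A"
  shows "\<alpha> g X \<in> orbit_hull A"
proof -
  have "orbit_hull A \<subseteq> \<alpha> g -` orbit_hull A"
  proof (rule orbit_hull_subset)
    fix h assume "h \<in> carrier G"
    then show "\<alpha> h A \<in> \<alpha> g -` orbit_hull A"
      using alpha_in_orbit_hull[of "g \<otimes>\<^bsub>G\<^esub> h" A] assms(1) by (simp add: alpha_mult_group mult_in)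
  qed (use assms in \<open>simp add: convex_linear_vimage linear_alpha convex_orbit_hull\<close>)
  then show ?thesis using assms(2) by auto
qed

text \<open>Averages of averages are averages, so several goals can be achieved one after the
  other.\<close>

lemma orbit_hull_trans: "X \<in> orbit_hull A \<Longrightarrow> Y \<in> orbit_hull X \<Longrightarrow> Y \<in> orbit_hull A"
  using orbit_hull_subset[of X "orbit_hull A"] alpha_orbit_hull convex_orbit_hull by blast

lemma convex_norm_pi_diff_le:
  assumes "x \<in> H"
  shows "convex {A. norm (\<pi> A x - y) \<le> r}"
proof -
  have "{A. norm (\<pi> A x - y) \<le> r} = (\<lambda>A. \<pi> A x) -` cball y r"
    by (auto simp: dist_norm norm_minus_commute)
  then show ?thesis using assms by (simp add: convex_linear_vimage linear_pi)
qed

lemma norm_pi_orbit_hull_le: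
  assumes "X \<in> orbit_hull A" and "x \<in> H"
  shows "norm (\<pi> X x) \<le> norm A * norm x"
proof -
  have "orbit_hull A \<subseteq> {X. norm (\<pi> X x - 0) \<le> norm A * norm x}"
    by (rule orbit_hull_subset)
      (use norm_pi_alpha_le assms convex_norm_pi_diff_le[of x 0] in auto)
  then show ?thesis using assms by auto
qed

text \<open>Transfers averages in the algebra to \<open>conv_ops\<close>. Agreement holds on
  \<open>H\<close> only, since off \<open>H\<close> the values of \<pi> are unconstrained.\<close>

lemma orbit_hull_conv_ops:
  assumes "X \<in> orbit_hull A"
  obtains S where "S \<in> conv_ops {\<pi> (\<alpha> g A) | g. g \<in> carrier G}" and "\<And>x. x \<in> H \<Longrightarrow> S x = \<pi> X x"
proof -
  obtain F u where F: "finite F" "F \<subseteq> {\<alpha> g A | g. g \<in> carrier G}" "\<forall>v\<in>F. 0 \<le> u v"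
      "sum u F = 1" "(\<Sum>v\<in>F. u v *\<^sub>R v) = X"
    using assms unfolding orbit_hull_def convex_hull_explicit by blast
  show ?thesis
  proof (rule that)
    show "(\<lambda>x. \<Sum>v\<in>F. u v *\<^sub>R \<pi> v x) \<in> conv_ops {\<pi> (\<alpha> g A) | g. g \<in> carrier G}"
      by (rule convex_combination_in_conv_ops) (use F in auto)
    show "(\<Sum>v\<in>F. u v *\<^sub>R \<pi> v x) = \<pi> X x" if "x \<in> H" for x
      unfolding F(5)[symmetric] using that by (simp add: pi_sum pi_scaleR)
  qed
qed

section \<open>Invariant vectors and the mean ergodic theorem\<close>

definition fixed_vectors :: "'h set" where
  "fixed_vectors = {\<xi> \<in> H. \<forall>g\<in>carrier G. U g \<xi> = \<xi>}"

lemma fixed_in_H: "\<eta> \<in> fixed_vectors \<Longrightarrow> \<eta> \<in> H"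
  by (simp add: fixed_vectors_def)

lemma fixed_U: "\<eta> \<in> fixed_vectors \<Longrightarrow> g \<in> carrier G \<Longrightarrow> U g \<eta> = \<eta>"
  by (simp add: fixed_vectors_def)

lemma pi_alpha_fixed: "\<eta> \<in> fixed_vectors \<Longrightarrow> g \<in> carrier G \<Longrightarrow> \<pi> (\<alpha> g A) \<eta> = U g (\<pi> A \<eta>)"
  using covariance[of g \<eta> A] by (simp add: fixed_in_H fixed_U)

lemma fixed_diff: "x \<in> fixed_vectors \<Longrightarrow> y \<in> fixed_vectors \<Longrightarrow> x - y \<in> fixed_vectors"
  by (simp add: fixed_vectors_def H_diff U_diff)

text \<open>Alaoglu--Birkhoff: the vector of least norm in the closed convex hull of the orbit of \<open>x\<close>
  is unique, hence invariant.\<close>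

lemma mean_ergodic:
  assumes "x \<in> H"
  obtains p where "p \<in> fixed_vectors" and "p \<in> closure (convex hull {U g x | g. g \<in> carrier G})"
    and "\<And>y. y \<in> fixed_vectors \<Longrightarrow> cinner y (x - p) = 0"
proof -
  define C where "C = convex hull {U g x | g. g \<in> carrier G}"
  define K where "K = closure C"
  have CH: "C \<subseteq> H"
    unfolding C_def by (rule hull_minimal) (use assms U_in csubspace_convex[OF csubspace_H] in auto)
  then have KH: "K \<subseteq> H" unfolding K_def by (rule closure_minimal) (rule closed_H)
  have "K \<noteq> {}" using one_in by (auto simp: K_def C_def)
  then obtain p where p: "p \<in> K" "\<And>z. z \<in> K \<Longrightarrow> norm z \<le> norm p \<Longrightarrow> z = p"
    using closed_convex_min_norm[of K] by (auto simp: K_def C_def convex_closure)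
  have pH: "p \<in> H" using p KH by blast
  \<comment> \<open>The hull is mapped into itself because \<open>U g\<close> permutes the orbit and
    is linear; the closure follows because \<open>U g\<close> is isometric.\<close>
  have U_K: "U g z \<in> K" if g: "g \<in> carrier G" and z: "z \<in> K" for g z
  proof -
    have UC: "C \<subseteq> {y \<in> H. U g y \<in> C}"
      unfolding C_def
    proof (rule hull_minimal)
      show "{U g x | g. g \<in> carrier G} \<subseteq>
          {y \<in> H. U g y \<in> convex hull {U g x | g. g \<in> carrier G}}"
        using g assms by (auto simp: U_in U_mult[symmetric] intro!: hull_inc exI mult_in)
      show "convex {y \<in> H. U g y \<in> convex hull {U g x | g. g \<in> carrier G}}"
        using convexD[OF csubspace_convex[OF csubspace_H]] g
        by (auto intro!: convexI simp: U_add U_scaleR H_scaleR intro: convexD[OF convex_convex_hull])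
    qed
    show ?thesis unfolding K_def closure_approachable
    proof (intro allI impI)
      fix e :: real assume "e > 0"
      then obtain w where w: "w \<in> C" "dist w z < e"
        using z unfolding K_def closure_approachable by blast
      have "w \<in> H" "z \<in> H" using w z CH KH by auto
      then have "dist (U g w) (U g z) = dist w z"
        using g by (simp add: dist_norm U_diff[symmetric] U_norm H_diff)
      moreover have "U g w \<in> C" using w UC by blast
      ultimately show "\<exists>y\<in>C. dist y (U g z) < e"
        using w(2) by (intro bexI[of _ "U g w"]) simp_all
    qed
  qed
  show ?thesis
  proof (rule that)
    show "p \<in> fixed_vectors"
      \<comment> \<open>\<open>U g p\<close> lies in \<open>K\<close> and has the norm of
        \<open>p\<close>, so uniqueness of the minimiser identifies the two.\<close>
      using p(2)[OF U_K[OF _ p(1)]] pH by (auto simp: fixed_vectors_def U_norm)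
    show "p \<in> closure (convex hull {U g x | g. g \<in> carrier G})"
      using p(1) by (simp add: K_def C_def)
    fix y assume y: "y \<in> fixed_vectors"
    \<comment> \<open>An invariant \<open>y\<close> has the same inner product with every point of
      the orbit, hence with its hull and closure, and so with \<open>p\<close>.\<close>
    have "C \<subseteq> cinner y -` {cinner y x}" unfolding C_def
    proof (rule hull_minimal)
      show "{U g x | g. g \<in> carrier G} \<subseteq> cinner y -` {cinner y x}"
        using U_cinner[of _ y x] y assms by (auto simp: fixed_U fixed_in_H)
      show "convex (cinner y -` {cinner y x})"
        by (intro convex_linear_vimage bounded_linear.linear[OF bounded_linear_cinner_right]) simp
    qed
    then have "K \<subseteq> cinner y -` {cinner y x}"
      unfolding K_def
      by (rule closure_minimal)
        (intro closed_vimage closed_singleton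
          bounded_linear.continuous_on[OF bounded_linear_cinner_right] continuous_on_id)
    then show "cinner y (x - p) = 0" using p by (auto simp: cinner_diff_right)
  qed
qed

abbreviation "E \<equiv> fixed_proj G H U"

lemma fixed_vector_zero:
  assumes "x \<in> fixed_vectors" and "\<And>y. y \<in> fixed_vectors \<Longrightarrow> cinner y x = 0"
  shows "x = 0"
  using power2_norm_cinner[of x] assms(2)[OF assms(1)] by simp

text \<open>Justifies the definite description in \<open>orth_proj\<close>: the difference of two
  candidates is invariant and orthogonal to every invariant vector, itself included.\<close>

lemma fixed_proj_eqI:
  assumes "p \<in> fixed_vectors" and "\<And>y. y \<in> fixed_vectors \<Longrightarrow> cinner y (x - p) = 0"
  shows "E x = p"
  unfolding fixed_proj_def orth_proj_def fixed_vectors_def[symmetric]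
proof (rule the_equality)
  fix q assume q: "q \<in> fixed_vectors \<and> (\<forall>y\<in>fixed_vectors. cinner y (x - q) = 0)"
  have "cinner y (q - p) = 0" if "y \<in> fixed_vectors" for y
    using q assms(2)[OF that] that by (simp add: cinner_diff_right)
  then have "q - p = 0" using fixed_vector_zero[of "q - p"] fixed_diff q assms(1) by blast
  then show "q = p" by simp
qed (use assms in blast)

lemma fixed_proj:
  assumes "x \<in> H"
  shows fixed_proj_fixed: "E x \<in> fixed_vectors"
    and fixed_proj_closure: "E x \<in> closure (convex hull {U g x | g. g \<in> carrier G})"
    and cinner_fixed_proj: "y \<in> fixed_vectors \<Longrightarrow> cinner y (E x) = cinner y x"
proof -
  obtain p where p: "p \<in> fixed_vectors" "p \<in> closure (convex hull {U g x | g. g \<in> carrier G})"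
    "\<And>y. y \<in> fixed_vectors \<Longrightarrow> cinner y (x - p) = 0"
    using mean_ergodic[OF assms] by blast
  have "E x = p" by (rule fixed_proj_eqI) (use p in auto)
  then show "E x \<in> fixed_vectors"
    and "E x \<in> closure (convex hull {U g x | g. g \<in> carrier G})"
    and "y \<in> fixed_vectors \<Longrightarrow> cinner y (E x) = cinner y x"
    using p by (auto simp: cinner_diff_right)
qed

text \<open>Since \<eta> is invariant,
  \<open>U g (\<pi> A \<eta>) = \<pi> (\<alpha> g A) \<eta>\<close>; the averages of vectors in the
  ergodic theorem thus come from averages of \<open>A\<close>.\<close>

lemma orbit_hull_ergodic:
  assumes \<eta>: "\<eta> \<in> fixed_vectors" and "e > 0"
  obtains X where "X \<in> orbit_hull A" and "norm (\<pi> X \<eta> - E (\<pi> A \<eta>)) \<le> e"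
proof -
  have \<eta>H: "\<eta> \<in> H" using \<eta> by (rule fixed_in_H)
  have "convex hull {U g (\<pi> A \<eta>) | g. g \<in> carrier G} \<subseteq> (\<lambda>X. \<pi> X \<eta>) ` orbit_hull A"
  proof (rule hull_minimal)
    show "{U g (\<pi> A \<eta>) | g. g \<in> carrier G} \<subseteq> (\<lambda>X. \<pi> X \<eta>) ` orbit_hull A"
      using pi_alpha_fixed[OF \<eta>, symmetric] alpha_in_orbit_hull by blast
    show "convex ((\<lambda>X. \<pi> X \<eta>) ` orbit_hull A)"
      using \<eta>H by (intro convex_linear_image linear_pi convex_orbit_hull)
  qed
  moreover obtain z where "z \<in> convex hull {U g (\<pi> A \<eta>) | g. g \<in> carrier G}"
    "dist z (E (\<pi> A \<eta>)) < e"
    using fixed_proj_closure[OF pi_in[OF \<eta>H], of A] \<open>e > 0\<close>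
    unfolding closure_approachable by blast
  ultimately obtain X where "X \<in> orbit_hull A" "dist (\<pi> X \<eta>) (E (\<pi> A \<eta>)) < e" by blast
  then show ?thesis by (intro that) (auto simp: dist_norm)
qed

text \<open>On an invariant vector \<open>\<alpha> g\<close> acts through the isometry
  \<open>U g\<close>, which fixes \<zeta>; further averaging therefore keeps the
  approximation.\<close>

lemma orbit_hull_stable:
  assumes \<eta>: "\<eta> \<in> fixed_vectors" and \<zeta>: "\<zeta> \<in> fixed_vectors"
    and "norm (\<pi> X \<eta> - \<zeta>) \<le> e" and "Y \<in> orbit_hull X"
  shows "norm (\<pi> Y \<eta> - \<zeta>) \<le> e"
proof -
  have "orbit_hull X \<subseteq> {Y. norm (\<pi> Y \<eta> - \<zeta>) \<le> e}"
  proof (rule orbit_hull_subset)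
    fix g assume g: "g \<in> carrier G"
    have "\<pi> (\<alpha> g X) \<eta> - \<zeta> = U g (\<pi> X \<eta> - \<zeta>)"
      using g \<eta> \<zeta> by (simp add: pi_alpha_fixed U_diff pi_in fixed_in_H fixed_U)
    then show "\<alpha> g X \<in> {Y. norm (\<pi> Y \<eta> - \<zeta>) \<le> e}"
      using assms g by (simp add: U_norm H_diff pi_in fixed_in_H)
  qed (use \<eta> in \<open>simp add: convex_norm_pi_diff_le fixed_in_H\<close>)
  then show ?thesis using assms by auto
qed

text \<open>The unitaries are absorbed by the two invariant vectors, so matrix elements between them
  allow replacing \<open>A\<close> by any of its averages.\<close>

lemma cinner_orbit_hull:
  assumes \<eta>: "\<eta> \<in> fixed_vectors" and \<zeta>: "\<zeta> \<in> fixed_vectors" and "X \<in> orbit_hull A"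
  shows "cinner \<zeta> (\<pi> X \<eta>) = cinner \<zeta> (\<pi> A \<eta>)"
proof -
  have "orbit_hull A \<subseteq> (\<lambda>X. cinner \<zeta> (\<pi> X \<eta>)) -` {cinner \<zeta> (\<pi> A \<eta>)}"
  proof (rule orbit_hull_subset)
    fix g assume g: "g \<in> carrier G"
    then show "\<alpha> g A \<in> (\<lambda>X. cinner \<zeta> (\<pi> X \<eta>)) -` {cinner \<zeta> (\<pi> A \<eta>)}"
      using U_cinner[OF g, of \<zeta> "\<pi> A \<eta>"] \<eta> \<zeta> by (simp add: pi_alpha_fixed fixed_U fixed_in_H pi_in)
  next
    have "linear (\<lambda>X. cinner \<zeta> (\<pi> X \<eta>))"
      using linear_compose[OF linear_pi bounded_linear.linear[OF bounded_linear_cinner_right]]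
        fixed_in_H[OF \<eta>] by (simp add: o_def)
    then show "convex ((\<lambda>X. cinner \<zeta> (\<pi> X \<eta>)) -` {cinner \<zeta> (\<pi> A \<eta>)})"
      by (rule convex_linear_vimage) simp
  qed
  then show ?thesis using assms by auto
qed

end

text \<open>Asymptotic abelianness, required only after averaging and in the given representation.\<close>

locale asymptotically_central_representation = covariant_representation G \<alpha> H \<pi> U
  for G :: "('g, 'm) monoid_scheme"
    and \<alpha> :: "'g \<Rightarrow> 'a::cstar_algebra \<Rightarrow> 'a"
    and H :: "'h::complex_hilbert set" and \<pi> U +
  assumes central: "finite \<B> \<Longrightarrow> e > 0 \<Longrightarrow>
    \<exists>Y\<in>orbit_hull X. \<forall>B\<in>\<B>. \<forall>x\<in>H. norm (\<pi> (Y * B - B * Y) x) \<le> e * norm x"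
begin

text \<open>First average for the ergodic theorem, then average the result for small commutators;
  \<open>orbit_hull_stable\<close> preserves what the first step achieved.\<close>

lemma ergodic_central:
  assumes "\<eta> \<in> fixed_vectors" and "finite \<B>" and "e > 0"
  shows "\<exists>Y\<in>orbit_hull A. norm (\<pi> Y \<eta> - E (\<pi> A \<eta>)) \<le> e \<and>
    (\<forall>B\<in>\<B>. \<forall>x\<in>H. norm (\<pi> (Y * B - B * Y) x) \<le> e * norm x)"
proof -
  obtain X where X: "X \<in> orbit_hull A" "norm (\<pi> X \<eta> - E (\<pi> A \<eta>)) \<le> e"
    using orbit_hull_ergodic[OF assms(1,3)] by blast
  obtain Y where Y: "Y \<in> orbit_hull X" "\<forall>B\<in>\<B>. \<forall>x\<in>H. norm (\<pi> (Y * B - B * Y) x) \<le> e * norm x"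
    using central[OF assms(2,3)] by blast
  have "E (\<pi> A \<eta>) \<in> fixed_vectors"
    using assms(1) by (simp add: fixed_proj_fixed pi_in fixed_in_H)
  then have "norm (\<pi> Y \<eta> - E (\<pi> A \<eta>)) \<le> e"
    using orbit_hull_stable[OF assms(1) _ X(2) Y(1)] by blast
  then show ?thesis using orbit_hull_trans[OF X(1) Y(1)] Y(2) by blast
qed

text \<open>With averages \<open>X\<close> of \<open>A\<close> and \<open>Y\<close> of
  \<open>B\<close> one has \<open>\<pi> Y p\<close> close to
  \<open>\<pi> Y (\<pi> X \<eta>)\<close>, this close to \<open>\<pi> X (\<pi> Y \<eta>)\<close>,
  and this close to \<open>\<pi> X q\<close>. Matrix elements with invariant vectors do not notice
  the averaging.\<close>

lemma fixed_proj_pi_commute: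
  assumes \<eta>: "\<eta> \<in> fixed_vectors"
  shows "E (\<pi> A (E (\<pi> B \<eta>))) = E (\<pi> B (E (\<pi> A \<eta>)))"
proof -
  define p q where "p = E (\<pi> A \<eta>)" and "q = E (\<pi> B \<eta>)"
  have \<eta>H: "\<eta> \<in> H" using \<eta> by (rule fixed_in_H)
  have p: "p \<in> fixed_vectors" and q: "q \<in> fixed_vectors"
    by (simp_all add: p_def q_def fixed_proj_fixed pi_in \<eta>H)
  have pH: "p \<in> H" and qH: "q \<in> H" using p q by (simp_all add: fixed_in_H)
  have eq: "cinner \<zeta> (\<pi> A q) = cinner \<zeta> (\<pi> B p)" if \<zeta>: "\<zeta> \<in> fixed_vectors" for \<zeta>
  proof -
    have "cmod (cinner \<zeta> (\<pi> A q) - cinner \<zeta> (\<pi> B p)) \<le>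
        0 + e * (norm \<zeta> * (norm A + norm \<eta> + norm B))" if "e > 0" for e
    proof -
      \<comment> \<open>The order matters: \<open>Y\<close> is chosen to almost commute with the
        \<open>X\<close> already fixed.\<close>
      obtain X where X: "X \<in> orbit_hull A" "norm (\<pi> X \<eta> - p) \<le> e"
        by (rule orbit_hull_ergodic[OF \<eta> \<open>e > 0\<close>, of A, folded p_def])
      obtain Y where Y: "Y \<in> orbit_hull B" "norm (\<pi> Y \<eta> - q) \<le> e"
        "\<forall>x\<in>H. norm (\<pi> (Y * X - X * Y) x) \<le> e * norm x"
        using ergodic_central[OF \<eta> _ \<open>e > 0\<close>, of "{X}" B, folded q_def] by auto
      have "\<pi> Y p - \<pi> X q = (\<pi> X (\<pi> Y \<eta> - q) - \<pi> Y (\<pi> X \<eta> - p)) + \<pi> (Y * X - X * Y) \<eta>"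
        using \<eta>H pH qH by (simp add: pi_vec_diff pi_in pi_diff pi_mult)
      then have "norm (\<pi> Y p - \<pi> X q) \<le>
          norm (\<pi> X (\<pi> Y \<eta> - q)) + norm (\<pi> Y (\<pi> X \<eta> - p)) + norm (\<pi> (Y * X - X * Y) \<eta>)"
        by (metis add_mono norm_triangle_le norm_triangle_ineq4 order_refl)
      also have "norm (\<pi> X (\<pi> Y \<eta> - q)) \<le> norm A * e"
        using norm_pi_orbit_hull_le[OF X(1), of "\<pi> Y \<eta> - q"] \<eta>H qH Y(2)
        by (meson H_diff pi_in mult_left_mono norm_ge_zero order_trans)
      also have "norm (\<pi> Y (\<pi> X \<eta> - p)) \<le> norm B * e"
        using norm_pi_orbit_hull_le[OF Y(1), of "\<pi> X \<eta> - p"] \<eta>H pH X(2)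
        by (meson H_diff pi_in mult_left_mono norm_ge_zero order_trans)
      also have "norm (\<pi> (Y * X - X * Y) \<eta>) \<le> e * norm \<eta>"
        using Y(3) \<eta>H by blast
      finally have *: "norm (\<pi> Y p - \<pi> X q) \<le> e * (norm A + norm \<eta> + norm B)"
        by (simp add: algebra_simps)
      have "cmod (cinner \<zeta> (\<pi> A q) - cinner \<zeta> (\<pi> B p)) = cmod (cinner \<zeta> (\<pi> Y p - \<pi> X q))"
        using cinner_orbit_hull[OF q \<zeta> X(1)] cinner_orbit_hull[OF p \<zeta> Y(1)]
        by (simp add: cinner_diff_right norm_minus_commute)
      also have "\<dots> \<le> norm \<zeta> * norm (\<pi> Y p - \<pi> X q)" by (rule cmod_cinner_le)
      also have "\<dots> \<le> norm \<zeta> * (e * (norm A + norm \<eta> + norm B))"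
        using * by (simp add: mult_left_mono)
      finally show ?thesis by (simp add: mult_ac)
    qed
    then have "cmod (cinner \<zeta> (\<pi> A q) - cinner \<zeta> (\<pi> B p)) \<le> 0"
      by (rule le_if_le_add_mult) (auto intro!: mult_nonneg_nonneg add_nonneg_nonneg)
    then show ?thesis by simp
  qed
  have "E (\<pi> A q) = E (\<pi> B p)"
    by (rule fixed_proj_eqI)
      (use eq pH in \<open>simp_all add: fixed_proj_fixed cinner_fixed_proj pi_in cinner_diff_right\<close>)
  then show ?thesis by (simp add: p_def q_def)
qed

lemma compression_commute:
  assumes "x \<in> H"
  shows "(E \<circ> \<pi> A \<circ> E) ((E \<circ> \<pi> B \<circ> E) x) = (E \<circ> \<pi> B \<circ> E) ((E \<circ> \<pi> A \<circ> E) x)"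
proof -
  have idem: "E y = y" if "y \<in> fixed_vectors" for y
    using that by (intro fixed_proj_eqI) (auto simp: cinner_zero_right)
  have Ex: "E x \<in> fixed_vectors" using assms by (rule fixed_proj_fixed)
  have "E (E (\<pi> C (E x))) = E (\<pi> C (E x))" for C
    by (rule idem[OF fixed_proj_fixed[OF pi_in[OF fixed_in_H[OF Ex]]]])
  then show ?thesis using fixed_proj_pi_commute[OF Ex] by simp
qed

text \<open>An operator commuting with the representation is determined by its value on the cyclic
  vector; here the value is prescribed as \<xi>. Almost central averages of \<open>A\<close> yield
  both the boundedness of the resulting map and its strong approximation.\<close>

lemma strong_limit_in_commutant:
  assumes \<Omega>: "\<Omega> \<in> fixed_vectors" and cyclic: "closure (range (\<lambda>B. \<pi> B \<Omega>)) = H"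
  obtains T where "T \<in> commutant H (range \<pi>)"
    and "\<And>Y e. finite Y \<Longrightarrow> Y \<subseteq> H \<Longrightarrow> e > 0 \<Longrightarrow> \<exists>X\<in>orbit_hull A. \<forall>y\<in>Y. norm (\<pi> X y - T y) < e"
proof -
  define \<xi> where "\<xi> = E (\<pi> A \<Omega>)"
  have \<Omega>H: "\<Omega> \<in> H" using \<Omega> by (rule fixed_in_H)
  have \<xi>H: "\<xi> \<in> H" by (simp add: \<xi>_def fixed_in_H fixed_proj_fixed pi_in \<Omega>H)
  \<comment> \<open>Moving \<open>X\<close> past \<open>B\<close> costs a commutator, after which
    \<open>\<pi> X \<Omega>\<close> is replaced by \<xi>.\<close>
  have approx: "norm (\<pi> X (\<pi> B \<Omega>) - \<pi> B \<xi>) \<le> e * (norm B + norm \<Omega>)"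
    if "norm (\<pi> X \<Omega> - \<xi>) \<le> e" "norm (\<pi> (X * B - B * X) \<Omega>) \<le> e * norm \<Omega>" for X B e
  proof -
    have "\<pi> X (\<pi> B \<Omega>) - \<pi> B \<xi> = \<pi> B (\<pi> X \<Omega> - \<xi>) + \<pi> (X * B - B * X) \<Omega>"
      using \<Omega>H \<xi>H by (simp add: pi_vec_diff pi_in pi_diff pi_mult)
    then have "norm (\<pi> X (\<pi> B \<Omega>) - \<pi> B \<xi>) \<le>
        norm (\<pi> B (\<pi> X \<Omega> - \<xi>)) + norm (\<pi> (X * B - B * X) \<Omega>)"
      by (simp add: norm_triangle_ineq)
    also have "norm (\<pi> B (\<pi> X \<Omega> - \<xi>)) \<le> norm B * e"
      using norm_pi_le[of "\<pi> X \<Omega> - \<xi>" B] \<Omega>H \<xi>H that(1)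
      by (meson H_diff pi_in mult_left_mono norm_ge_zero order_trans)
    also note that(2)
    finally show ?thesis by (simp add: algebra_simps)
  qed
  \<comment> \<open>The averages satisfy this bound with the constant \<open>norm A\<close>, and it
    survives the limit. Applied to differences it shows that \<open>\<pi> B \<Omega>\<close>
    determines \<open>\<pi> B \<xi>\<close>.\<close>
  have bound: "norm (\<pi> B \<xi>) \<le> norm A * norm (\<pi> B \<Omega>)" for B
  proof (rule le_if_le_add_mult)
    fix e :: real assume "e > 0"
    obtain X where X: "X \<in> orbit_hull A" "norm (\<pi> X \<Omega> - \<xi>) \<le> e"
      "norm (\<pi> (X * B - B * X) \<Omega>) \<le> e * norm \<Omega>"
      using ergodic_central[OF \<Omega> _ \<open>e > 0\<close>, of "{B}" A, folded \<xi>_def] \<Omega>H by auto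
    have "norm (\<pi> B \<xi>) \<le> norm (\<pi> X (\<pi> B \<Omega>)) + norm (\<pi> X (\<pi> B \<Omega>) - \<pi> B \<xi>)"
      by (metis norm_minus_commute norm_triangle_sub)
    also have "\<dots> \<le> norm A * norm (\<pi> B \<Omega>) + e * (norm B + norm \<Omega>)"
      using norm_pi_orbit_hull_le[OF X(1), of "\<pi> B \<Omega>"] approx[OF X(2) X(3)] \<Omega>H
      by (intro add_mono) (simp_all add: pi_in)
    finally show "norm (\<pi> B \<xi>) \<le> norm A * norm (\<pi> B \<Omega>) + e * (norm B + norm \<Omega>)" .
  qed simp
  have seq: "\<exists>Bs. (\<lambda>n. \<pi> (Bs n) \<Omega>) \<longlonglongrightarrow> x" if "x \<in> H" for x
  proof -
    obtain f where f: "\<forall>n. f n \<in> range (\<lambda>B. \<pi> B \<Omega>)" "f \<longlonglongrightarrow> x"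
      using \<open>x \<in> H\<close> unfolding cyclic[symmetric] closure_sequential by blast
    then have "\<forall>n. \<exists>B. f n = \<pi> B \<Omega>" by blast
    then obtain Bs where "\<forall>n. f n = \<pi> (Bs n) \<Omega>" by metis
    then have "f = (\<lambda>n. \<pi> (Bs n) \<Omega>)" by auto
    then show ?thesis using f(2) by blast
  qed
  have diff_bound: "norm (\<pi> B \<xi> - \<pi> C \<xi>) \<le> norm A * norm (\<pi> B \<Omega> - \<pi> C \<Omega>)" for B C
    using bound[of "B - C"] \<Omega>H \<xi>H by (simp add: pi_diff)
  \<comment> \<open>Extension by continuity: the images form a Cauchy sequence, and their limit does
    not depend on the approximating sequence.\<close>
  have "\<exists>y. \<forall>Bs. (\<lambda>n. \<pi> (Bs n) \<Omega>) \<longlonglongrightarrow> x \<longrightarrow> (\<lambda>n. \<pi> (Bs n) \<xi>) \<longlonglongrightarrow> y" if "x \<in> H" for x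
  proof -
    obtain Bs where Bs: "(\<lambda>n. \<pi> (Bs n) \<Omega>) \<longlonglongrightarrow> x" using seq[OF \<open>x \<in> H\<close>] by blast
    have "Cauchy (\<lambda>n. \<pi> (Bs n) \<xi>)"
    proof (rule CauchyI)
      fix e :: real assume "e > 0"
      then have "e / (norm A + 1) > 0" by (simp add: add_nonneg_pos)
      then obtain M where M: "\<forall>m\<ge>M. \<forall>n\<ge>M. norm (\<pi> (Bs m) \<Omega> - \<pi> (Bs n) \<Omega>) < e / (norm A + 1)"
        using CauchyD[OF LIMSEQ_imp_Cauchy[OF Bs]] by blast
      have "norm (\<pi> (Bs m) \<xi> - \<pi> (Bs n) \<xi>) < e" if "m \<ge> M" "n \<ge> M" for m n
      proof -
        have "norm (\<pi> (Bs m) \<xi> - \<pi> (Bs n) \<xi>) \<le> norm A * norm (\<pi> (Bs m) \<Omega> - \<pi> (Bs n) \<Omega>)"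
          by (rule diff_bound)
        also have "\<dots> \<le> (norm A + 1) * norm (\<pi> (Bs m) \<Omega> - \<pi> (Bs n) \<Omega>)"
          by (simp add: mult_right_mono)
        also have "\<dots> < e"
          using M that norm_ge_zero[of A] by (simp add: pos_less_divide_eq mult.commute)
        finally show ?thesis .
      qed
      then show "\<exists>M. \<forall>m\<ge>M. \<forall>n\<ge>M. norm (\<pi> (Bs m) \<xi> - \<pi> (Bs n) \<xi>) < e" by blast
    qed
    then obtain y where y: "(\<lambda>n. \<pi> (Bs n) \<xi>) \<longlonglongrightarrow> y"
      using Cauchy_convergent convergent_def by blast
    have "(\<lambda>n. \<pi> (Cs n) \<xi>) \<longlonglongrightarrow> y" if Cs: "(\<lambda>n. \<pi> (Cs n) \<Omega>) \<longlonglongrightarrow> x" for Cs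
    proof -
      have "(\<lambda>n. norm A * norm (\<pi> (Cs n) \<Omega> - \<pi> (Bs n) \<Omega>)) \<longlonglongrightarrow> norm A * norm (x - x)"
        by (intro tendsto_intros Bs Cs)
      then have "(\<lambda>n. \<pi> (Cs n) \<xi> - \<pi> (Bs n) \<xi>) \<longlonglongrightarrow> 0"
        by (intro Lim_null_comparison[OF always_eventually[OF allI[OF diff_bound]]]) simp
      from tendsto_add[OF this y] show ?thesis by simp
    qed
    then show ?thesis by blast
  qed
  then obtain T where T:
    "\<And>x Bs. x \<in> H \<Longrightarrow> (\<lambda>n. \<pi> (Bs n) \<Omega>) \<longlonglongrightarrow> x \<Longrightarrow> (\<lambda>n. \<pi> (Bs n) \<xi>) \<longlonglongrightarrow> T x"
    by metis
  have T_in: "T x \<in> H" if "x \<in> H" for x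
    using seq[OF that] T[OF that] closed_sequentially[OF closed_H] pi_in[OF \<xi>H] by metis
  have T_add: "T (x + y) = T x + T y" if xy: "x \<in> H" "y \<in> H" for x y
  proof -
    obtain Bs Cs where BC: "(\<lambda>n. \<pi> (Bs n) \<Omega>) \<longlonglongrightarrow> x" "(\<lambda>n. \<pi> (Cs n) \<Omega>) \<longlonglongrightarrow> y"
      using seq xy by metis
    have "(\<lambda>n. \<pi> (Bs n + Cs n) \<Omega>) \<longlonglongrightarrow> x + y"
      using tendsto_add[OF BC] \<Omega>H by (simp add: pi_add)
    then have "(\<lambda>n. \<pi> (Bs n) \<xi> + \<pi> (Cs n) \<xi>) \<longlonglongrightarrow> T (x + y)"
      using T[OF H_add[OF xy], of "\<lambda>n. Bs n + Cs n"] \<xi>H by (simp add: pi_add)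
    then show ?thesis
      using tendsto_add[OF T[OF xy(1) BC(1)] T[OF xy(2) BC(2)]] LIMSEQ_unique by blast
  qed
  have T_pi: "T (\<pi> D x) = \<pi> D (T x)" if x: "x \<in> H" for D x
  proof -
    obtain Bs where Bs: "(\<lambda>n. \<pi> (Bs n) \<Omega>) \<longlonglongrightarrow> x" using seq[OF x] by blast
    have lim: "(\<lambda>n. \<pi> D (f n)) \<longlonglongrightarrow> \<pi> D y" if f: "\<And>n. f n \<in> H" "y \<in> H" "f \<longlonglongrightarrow> y" for f y
    proof -
      have "(\<lambda>n. norm D * norm (f n - y)) \<longlonglongrightarrow> norm D * norm (y - y)"
        by (intro tendsto_intros f)
      then have lim0: "(\<lambda>n. norm D * norm (f n - y)) \<longlonglongrightarrow> 0" by simp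
      have "norm (\<pi> D (f n) - \<pi> D y) \<le> norm D * norm (f n - y)" for n
        using norm_pi_le[OF H_diff[OF f(1)[of n] f(2)], of D] f(1,2) by (simp add: pi_vec_diff)
      then have "(\<lambda>n. \<pi> D (f n) - \<pi> D y) \<longlonglongrightarrow> 0"
        by (intro Lim_null_comparison[OF _ lim0] always_eventually allI)
      then show ?thesis using LIM_zero_iff by blast
    qed
    \<comment> \<open>Multiplying an approximating sequence for \<open>x\<close> by \<open>D\<close>
      from the left gives one for \<open>\<pi> D x\<close>.\<close>
    have "(\<lambda>n. \<pi> (D * Bs n) \<Omega>) \<longlonglongrightarrow> \<pi> D x"
      using lim[OF _ x Bs] \<Omega>H by (simp add: pi_mult pi_in)
    then have "(\<lambda>n. \<pi> D (\<pi> (Bs n) \<xi>)) \<longlonglongrightarrow> T (\<pi> D x)"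
      using T[OF pi_in[OF x], of "\<lambda>n. D * Bs n" D] \<xi>H by (simp add: pi_mult)
    moreover have "(\<lambda>n. \<pi> D (\<pi> (Bs n) \<xi>)) \<longlonglongrightarrow> \<pi> D (T x)"
      using T[OF x Bs] \<xi>H x by (intro lim) (auto simp: pi_in T_in)
    ultimately show ?thesis using LIMSEQ_unique by blast
  qed
  \<comment> \<open>Complex homogeneity is commutation with the image of the scalar
    \<open>c *\<^sub>C 1\<close>.\<close>
  have T_scaleC: "T (c *\<^sub>C x) = c *\<^sub>C T x" if "x \<in> H" for c x
    using T_pi[OF that, of "c *\<^sub>C 1"] that by (simp add: pi_scaleC pi_one T_in)
  have T_bound: "norm (T x) \<le> norm A * norm x" if "x \<in> H" for x
  proof -
    obtain Bs where Bs: "(\<lambda>n. \<pi> (Bs n) \<Omega>) \<longlonglongrightarrow> x" using seq[OF \<open>x \<in> H\<close>] by blast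
    have "(\<lambda>n. norm A * norm (\<pi> (Bs n) \<Omega>)) \<longlonglongrightarrow> norm A * norm x"
      by (intro tendsto_intros Bs)
    with tendsto_norm[OF T[OF that Bs]] show ?thesis
      by (rule LIMSEQ_le) (use bound in blast)
  qed
  have T_cyclic: "T (\<pi> B \<Omega>) = \<pi> B \<xi>" for B
    using T[OF pi_in[OF \<Omega>H, of B], of "\<lambda>_. B"] by (simp add: LIMSEQ_const_iff)
  have T_diff: "T (x - y) = T x - T y" if "x \<in> H" "y \<in> H" for x y
    using T_add[of "x - y" y] that by (simp add: H_diff)
  show ?thesis
  proof (rule that)
    show "T \<in> commutant H (range \<pi>)"
      unfolding commutant_def bounded_ops_def
      using T_in T_add T_scaleC T_bound T_pi by blast
    fix Y :: "'h set" and e :: real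
    assume Y: "finite Y" "Y \<subseteq> H" and e: "e > 0"
    \<comment> \<open>Replacing \<open>y\<close> by a vector \<open>\<pi> (B y) \<Omega>\<close>
      costs at most \<open>2 * norm A * \<delta>\<close>, hence at most
      \<open>e / 2\<close>.\<close>
    define \<delta> where "\<delta> = e / (4 * (norm A + 1))"
    have \<delta>: "\<delta> > 0" using e by (simp add: \<delta>_def add_nonneg_pos)
    have "\<forall>y\<in>Y. \<exists>B. norm (y - \<pi> B \<Omega>) < \<delta>"
    proof
      fix y assume "y \<in> Y"
      then have "y \<in> closure (range (\<lambda>B. \<pi> B \<Omega>))" using Y cyclic by blast
      then show "\<exists>B. norm (y - \<pi> B \<Omega>) < \<delta>"
        using \<delta> unfolding closure_approachable dist_norm by (metis norm_minus_commute rangeE)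
    qed
    then obtain B where B: "\<And>y. y \<in> Y \<Longrightarrow> norm (y - \<pi> (B y) \<Omega>) < \<delta>" by metis
    \<comment> \<open>\<open>N\<close> dominates \<open>norm (B y) + norm \<Omega>\<close> for all
      \<open>y\<close> in \<open>Y\<close> at once, so the error from \<open>approx\<close> is at
      most \<open>e / 4\<close>.\<close>
    define N where "N = norm \<Omega> + (\<Sum>y\<in>Y. norm (B y)) + 1"
    have N: "N > 0" by (simp add: N_def sum_nonneg add_nonneg_pos)
    define \<epsilon> where "\<epsilon> = e / (4 * N)"
    have \<epsilon>: "\<epsilon> > 0" using e N by (simp add: \<epsilon>_def)
    obtain X where X: "X \<in> orbit_hull A" "norm (\<pi> X \<Omega> - \<xi>) \<le> \<epsilon>"
      "\<forall>C\<in>B ` Y. \<forall>x\<in>H. norm (\<pi> (X * C - C * X) x) \<le> \<epsilon> * norm x"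
      using ergodic_central[OF \<Omega> _ \<epsilon>, of "B ` Y" A, folded \<xi>_def] Y by auto
    have "norm (\<pi> X y - T y) < e" if y: "y \<in> Y" for y
    proof -
      have yH: "y \<in> H" using y Y by blast
      define z where "z = y - \<pi> (B y) \<Omega>"
      have zH: "z \<in> H" using yH \<Omega>H by (simp add: z_def H_diff pi_in)
      have z: "norm z < \<delta>" using B y by (simp add: z_def)
      have "\<pi> X y - T y = (\<pi> X z - T z) + (\<pi> X (\<pi> (B y) \<Omega>) - \<pi> (B y) \<xi>)"
        using yH \<Omega>H by (simp add: z_def pi_vec_diff T_diff pi_in T_cyclic)
      then have "norm (\<pi> X y - T y) \<le>
          (norm (\<pi> X z) + norm (T z)) + norm (\<pi> X (\<pi> (B y) \<Omega>) - \<pi> (B y) \<xi>)"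
        by (metis add_mono norm_triangle_le norm_triangle_ineq4 order_refl)
      also have "\<dots> \<le> (norm A * norm z + norm A * norm z) + \<epsilon> * (norm (B y) + norm \<Omega>)"
        using y zH \<Omega>H X
        by (intro add_mono norm_pi_orbit_hull_le T_bound approx) auto
      also have "norm A * norm z + norm A * norm z \<le> e / 2"
      proof -
        have "norm A * norm z \<le> (norm A + 1) * \<delta>" using z by (intro mult_mono) auto
        also have "\<dots> = e / 4"
          using norm_ge_zero[of A] by (simp add: \<delta>_def field_simps add_nonneg_eq_0_iff)
        finally show ?thesis by simp
      qed
      also have "\<epsilon> * (norm (B y) + norm \<Omega>) \<le> e / 4"
      proof -
        have "norm (B y) \<le> (\<Sum>y\<in>Y. norm (B y))"
          using y Y by (intro member_le_sum) auto
        then have "\<epsilon> * (norm (B y) + norm \<Omega>) \<le> \<epsilon> * N"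
          using \<epsilon> by (intro mult_left_mono) (auto simp: N_def)
        also have "\<dots> = e / 4" using N by (simp add: \<epsilon>_def)
        finally show ?thesis .
      qed
      finally show ?thesis using e by simp
    qed
    then show "\<exists>X\<in>orbit_hull A. \<forall>y\<in>Y. norm (\<pi> X y - T y) < e" using X(1) by blast
  qed
qed

lemma weak_closure_meets_commutant:
  assumes "\<Omega> \<in> fixed_vectors" and "closure (range (\<lambda>B. \<pi> B \<Omega>)) = H"
  shows "weak_operator_topology H closure_of conv_ops {\<pi> (\<alpha> g A) | g. g \<in> carrier G}
    \<inter> commutant H (range \<pi>) \<noteq> {}"
proof -
  obtain T where T: "T \<in> commutant H (range \<pi>)"
    and lim: "\<And>Y e. finite Y \<Longrightarrow> Y \<subseteq> H \<Longrightarrow> e > 0 \<Longrightarrow> \<exists>X\<in>orbit_hull A. \<forall>y\<in>Y. norm (\<pi> X y - T y) < e"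
    using strong_limit_in_commutant[OF assms, of A] by blast
  have Tb: "T \<in> bounded_ops H" using T by (simp add: commutant_def)
  have "T \<in> weak_operator_topology H closure_of conv_ops {\<pi> (\<alpha> g A) | g. g \<in> carrier G}"
    unfolding in_closure_of
  proof (intro conjI allI impI)
    \<comment> \<open>This subbasic set is all of \<open>bounded_ops H\<close>, which puts
      \<open>T\<close> into the topological space.\<close>
    have "{T \<in> bounded_ops H. cinner 0 (T 0) \<in> UNIV} \<subseteq> topspace (weak_operator_topology H)"
      unfolding weak_operator_topology_def topology_generated_by_topspace
      by (rule Union_upper) (use H_zero in blast)
    then show "T \<in> topspace (weak_operator_topology H)" using Tb by blast
    fix W assume "T \<in> W \<and> openin (weak_operator_topology H) W"
    then have "openin (weak_operator_topology H) W" "T \<in> W" by auto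
    from weak_operator_nhd[OF this] obtain Y e where Y: "finite Y" "Y \<subseteq> H" "e > 0"
      "\<forall>S\<in>bounded_ops H. (\<forall>y\<in>Y. norm (S y - T y) < e) \<longrightarrow> S \<in> W"
      by blast
    obtain X where X: "X \<in> orbit_hull A" "\<forall>y\<in>Y. norm (\<pi> X y - T y) < e"
      using lim[OF Y(1-3)] by blast
    obtain S where S: "S \<in> conv_ops {\<pi> (\<alpha> g A) | g. g \<in> carrier G}" "\<And>x. x \<in> H \<Longrightarrow> S x = \<pi> X x"
      using orbit_hull_conv_ops[OF X(1)] by blast
    have "S \<in> bounded_ops H"
      using pi_bounded_ops[of X] S(2) by (simp add: bounded_ops_def H_add H_scaleC)
    moreover have "\<forall>y\<in>Y. norm (S y - T y) < e" using X(2) S(2) Y(2) by (metis subsetD)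
    ultimately show "\<exists>S. S \<in> conv_ops {\<pi> (\<alpha> g A) | g. g \<in> carrier G} \<and> S \<in> W"
      using Y(4) S(1) by blast
  qed
  then show ?thesis using T by blast
qed

end

section \<open>The CAR algebra\<close>

lemma bounded_linear_scaleC: "bounded_linear ((*\<^sub>C) c :: 'a::cstar_algebra \<Rightarrow> 'a)"
proof (rule bounded_linear_intro[where K = "cmod c"])
  show "c *\<^sub>C (r *\<^sub>R x) = r *\<^sub>R (c *\<^sub>C x)" for r and x :: 'a
    by (simp add: scaleR_scaleC scaleC_scaleC mult.commute)
qed (simp_all add: scaleC_add_right norm_scaleC mult.commute)

lemma scaleC_minus_right: "c *\<^sub>C (- x) = - (c *\<^sub>C (x::'a::complex_vector))"
  using scaleC_diff_right[of c 0 x] by (simp add: scaleC_zero_right)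

lemma star_subalgebra_closure:
  fixes S :: "'a::cstar_algebra set"
  assumes "star_subalgebra S"
  shows "star_subalgebra (closure S)"
proof -
  have S: "0 \<in> S" "1 \<in> S" "\<And>x y. x \<in> S \<Longrightarrow> y \<in> S \<Longrightarrow> x + y \<in> S"
    "\<And>x y. x \<in> S \<Longrightarrow> y \<in> S \<Longrightarrow> x * y \<in> S" "\<And>x c. x \<in> S \<Longrightarrow> c *\<^sub>C x \<in> S"
    "\<And>x. x \<in> S \<Longrightarrow> star x \<in> S"
    using assms by (auto simp: star_subalgebra_def csubspace_def)
  have "x + y \<in> closure S \<and> x * y \<in> closure S" if xy: "x \<in> closure S" "y \<in> closure S" for x y
  proof -
    obtain f g where f: "\<forall>n. f n \<in> S" "f \<longlonglongrightarrow> x" and g: "\<forall>n. g n \<in> S" "g \<longlonglongrightarrow> y"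
      using xy unfolding closure_sequential by blast
    show ?thesis
      unfolding closure_sequential using f g S(3,4) tendsto_add[OF f(2) g(2)] tendsto_mult[OF f(2) g(2)]
      by (intro conjI) (rule exI, rule conjI[rotated], assumption, simp)+
  qed
  moreover have lin: "h x \<in> closure S"
    if "x \<in> closure S" "bounded_linear h" "\<And>x. x \<in> S \<Longrightarrow> h x \<in> S" for x and h :: "'a \<Rightarrow> 'a"
    using closure_bounded_linear_image_subset[OF that(2), of S] that(1,3)
      closure_mono[of "h ` S" S] by blast
  moreover have "c *\<^sub>C x \<in> closure S" "star x \<in> closure S" if "x \<in> closure S" for x c
    using lin[OF that bounded_linear_scaleC S(5)] lin[OF that bounded_linear_star S(6)] by auto
  moreover have "0 \<in> closure S" "1 \<in> closure S" using S(1,2) closure_subset by blast+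
  ultimately show ?thesis by (simp add: star_subalgebra_def csubspace_def)
qed

text \<open>\<open>parity_element a F p x\<close>: \<open>x\<close> is a noncommutative polynomial in the generators indexed
  by \<open>F\<close>, all of whose monomials have odd length if \<open>p\<close> and even length otherwise.\<close>

inductive parity_element :: "('j \<Rightarrow> 'a::cstar_algebra) \<Rightarrow> 'j set \<Rightarrow> bool \<Rightarrow> 'a \<Rightarrow> bool"
  for a F where
  zero: "parity_element a F p 0"
| one: "parity_element a F False 1"
| gen: "j \<in> F \<Longrightarrow> parity_element a F True (a j)"
| star_gen: "j \<in> F \<Longrightarrow> parity_element a F True (star (a j))"
| add: "parity_element a F p x \<Longrightarrow> parity_element a F p y \<Longrightarrow> parity_element a F p (x + y)"
| scaleC: "parity_element a F p x \<Longrightarrow> parity_element a F p (c *\<^sub>C x)"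
| mult: "parity_element a F p x \<Longrightarrow> parity_element a F q y \<Longrightarrow> parity_element a F (p = (\<not> q)) (x * y)"

lemma parity_element_mono: "parity_element a F p x \<Longrightarrow> F \<subseteq> K \<Longrightarrow> parity_element a K p x"
  by (induction rule: parity_element.induct) (auto intro: parity_element.intros)

text \<open>Reversing a product does not change the exclusive or of the parities, which is written
  \<open>p = (\<not> q)\<close>.\<close>

lemma parity_element_star: "parity_element a F p x \<Longrightarrow> parity_element a F p (star x)"
proof (induction rule: parity_element.induct)
  case (mult p x q y)
  then have "parity_element a F (q = (\<not> p)) (star y * star x)" by (intro parity_element.mult)
  then show ?case by (cases p; cases q) (simp_all add: star_mult)
qed (auto simp: star_zero star_one star_add star_scaleC star_star intro: parity_element.intros)

lemma parity_element_image:
  assumes "parity_element a F p x" and "star_automorphism f" and "\<And>j. j \<in> F \<Longrightarrow> f (a j) = a (g j)"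
  shows "parity_element a (g ` F) p (f x)"
proof -
  have f: "f (x + y) = f x + f y" "f (c *\<^sub>C x) = c *\<^sub>C f x" "f (x * y) = f x * f y"
    "f (star x) = star (f x)" for x y c
    using assms(2) by (simp_all add: star_automorphism_def)
  have f0: "f 0 = 0" using f(1)[of 0 0] by simp
  \<comment> \<open>Unitality comes from surjectivity:
    \<open>1 = f u = f 1 * f u = f 1\<close>.\<close>
  obtain u where "f u = 1" using assms(2) unfolding star_automorphism_def by (metis bij_pointE)
  then have f1: "f 1 = 1" using f(3)[of 1 u] by simp
  show ?thesis
    using assms(1)
    by (induction rule: parity_element.induct)
      (auto simp: f f0 f1 assms(3) intro: parity_element.intros)
qed

text \<open>Passing \<open>u\<close> through a monomial produces one sign for each factor, so only
  the parity of its length counts.\<close>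

lemma parity_element_anticommute_generators:
  assumes "parity_element a K q y"
    and "\<And>k. k \<in> K \<Longrightarrow> u * a k = - (a k * u)"
    and "\<And>k. k \<in> K \<Longrightarrow> u * star (a k) = - (star (a k) * u)"
  shows "u * y = (if q then - (y * u) else y * u)"
  using assms(1)
proof (induction rule: parity_element.induct)
  case (mult p x q y)
  have "u * (x * y) = (if p then - (x * (u * y)) else x * (u * y))"
    using mult.IH(1) by (simp add: mult.assoc[symmetric])
  then show ?case using mult.IH(2) by (simp add: mult.assoc)
qed (auto simp: assms algebra_simps mult_scaleC_left mult_scaleC_right
    scaleC_minus_right)

lemma is_CAR_anticommute:
  assumes "is_CAR J a" and "j \<in> J" "k \<in> J" "j \<noteq> k"
  shows "a j * a k = - (a k * a j)" and "a j * star (a k) = - (star (a k) * a j)"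
    and "star (a j) * a k = - (a k * star (a j))"
    and "star (a j) * star (a k) = - (star (a k) * star (a j))"
  using assms unfolding is_CAR_def by (simp_all add: eq_neg_iff_add_eq_0 add.commute)

text \<open>Graded commutativity for disjoint index sets. Induction on \<open>x\<close>; the
  generators, which anticommute with all generators indexed by \<open>K\<close>, are the base
  case.\<close>

lemma parity_element_commute:
  assumes "is_CAR J a" and "F \<subseteq> J" "K \<subseteq> J" "F \<inter> K = {}"
    and "parity_element a F p x" and y: "parity_element a K q y"
  shows "x * y = (if p \<and> q then - (y * x) else y * x)"
  using assms(5)
proof (induction rule: parity_element.induct)
  case (gen j)
  then show ?case
    using parity_element_anticommute_generators[OF y, of "a j"] assms(1-4)
      is_CAR_anticommute[OF assms(1), of j] by force
next
  case (star_gen j)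
  then show ?case
    using parity_element_anticommute_generators[OF y, of "star (a j)"] assms(1-4)
      is_CAR_anticommute[OF assms(1), of j] by force
next
  case (mult p x p' x')
  have "x * x' * y = (if p' \<and> q then - (x * y * x') else x * y * x')"
    using mult.IH(2) by (simp add: mult.assoc)
  then show ?case using mult.IH(1) by (auto simp add: mult.assoc)
qed (auto simp: algebra_simps mult_scaleC_left mult_scaleC_right
    scaleC_minus_right)

text \<open>The unital star-algebra generated by the \<open>a j\<close> with
  \<open>j \<in> F\<close>, presented as even plus odd part because the two parts are averaged by
  different arguments.\<close>

definition local_elements :: "('j \<Rightarrow> 'a::cstar_algebra) \<Rightarrow> 'j set \<Rightarrow> 'a set" where
  "local_elements a F = {x + y | x y. parity_element a F False x \<and> parity_element a F True y}"

lemma local_elements_mono: "F \<subseteq> K \<Longrightarrow> local_elements a F \<subseteq> local_elements a K"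
  unfolding local_elements_def using parity_element_mono by blast

lemma star_subalgebra_local_elements: "star_subalgebra (local_elements a F)"
proof -
  have "x \<in> local_elements a F" if "parity_element a F p x" for x p
    using that parity_element.zero[of a F "\<not> p"] unfolding local_elements_def
    by (cases p) (force intro: exI[of _ 0] exI[of _ x])+
  note single = this
  have add: "u + v \<in> local_elements a F" if uv: "u \<in> local_elements a F" "v \<in> local_elements a F" for u v
  proof -
    obtain x y x' y' where "u = x + y" "v = x' + y'" "parity_element a F False x"
      "parity_element a F True y" "parity_element a F False x'" "parity_element a F True y'"
      using uv unfolding local_elements_def by blast
    moreover from this have "u + v = (x + x') + (y + y')" by (simp add: algebra_simps)
    ultimately show ?thesis unfolding local_elements_def using parity_element.add by blast
  qed
  have "u * v \<in> local_elements a F" if uv: "u \<in> local_elements a F" "v \<in> local_elements a F" for u v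
  proof -
    obtain x y x' y' where "u = x + y" "v = x' + y'" "parity_element a F False x"
      "parity_element a F True y" "parity_element a F False x'" "parity_element a F True y'"
      using uv unfolding local_elements_def by blast
    moreover from this have "u * v = (x * x' + y * y') + (x * y' + y * x')"
      by (simp add: algebra_simps)
    moreover have "x * x' \<in> local_elements a F" "y * y' \<in> local_elements a F"
      "x * y' \<in> local_elements a F" "y * x' \<in> local_elements a F"
      using calculation parity_element.mult[of a F] by (blast intro: single)+
    ultimately show ?thesis by (simp only: add)
  qed
  moreover have "c *\<^sub>C u \<in> local_elements a F" "star u \<in> local_elements a F"
    if u: "u \<in> local_elements a F" for u c
  proof -
    obtain x y where xy: "u = x + y" "parity_element a F False x" "parity_element a F True y"
      using u unfolding local_elements_def by blast
    show "c *\<^sub>C u \<in> local_elements a F"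
      unfolding xy scaleC_add_right using xy
      by (intro add) (auto intro: single parity_element.scaleC)
    show "star u \<in> local_elements a F"
      unfolding xy star_add using xy by (intro add) (auto intro: single parity_element_star)
  qed
  moreover have "0 \<in> local_elements a F" "1 \<in> local_elements a F"
    using single parity_element.zero parity_element.one by blast+
  ultimately show ?thesis using add by (simp add: star_subalgebra_def csubspace_def)
qed

text \<open>The local algebras form a directed family, so their union is a star-subalgebra; its
  closure contains the generators and hence everything.\<close>

lemma local_elements_dense:
  assumes "is_CAR J a"
  shows "closure (\<Union>F\<in>{F. finite F \<and> F \<subseteq> J}. local_elements a F) = UNIV"
proof -
  define L where "L = (\<Union>F\<in>{F. finite F \<and> F \<subseteq> J}. local_elements a F)"
  have sub: "0 \<in> local_elements a F" "1 \<in> local_elements a F"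
    "\<And>x y. x \<in> local_elements a F \<Longrightarrow> y \<in> local_elements a F \<Longrightarrow> x + y \<in> local_elements a F"
    "\<And>x y. x \<in> local_elements a F \<Longrightarrow> y \<in> local_elements a F \<Longrightarrow> x * y \<in> local_elements a F"
    "\<And>x c. x \<in> local_elements a F \<Longrightarrow> c *\<^sub>C x \<in> local_elements a F"
    "\<And>x. x \<in> local_elements a F \<Longrightarrow> star x \<in> local_elements a F" for F
    using star_subalgebra_local_elements[of a F] by (auto simp: star_subalgebra_def csubspace_def)
  have directed: "\<exists>F. finite F \<and> F \<subseteq> J \<and> x \<in> local_elements a F \<and> y \<in> local_elements a F"
    if "x \<in> L" "y \<in> L" for x y
  proof -
    from \<open>x \<in> L\<close> obtain F where F: "finite F" "F \<subseteq> J" "x \<in> local_elements a F"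
      unfolding L_def by blast
    from \<open>y \<in> L\<close> obtain K where K: "finite K" "K \<subseteq> J" "y \<in> local_elements a K"
      unfolding L_def by blast
    show ?thesis
    proof (intro exI conjI)
      show "x \<in> local_elements a (F \<union> K)" "y \<in> local_elements a (F \<union> K)"
        using F(3) K(3) local_elements_mono[of F "F \<union> K" a] local_elements_mono[of K "F \<union> K" a]
        by auto
    qed (use F K in auto)
  qed
  have LI: "x \<in> L" if "finite F" "F \<subseteq> J" "x \<in> local_elements a F" for x F
    using that unfolding L_def by blast
  have "x + y \<in> L" "x * y \<in> L" if xy: "x \<in> L" "y \<in> L" for x y
  proof -
    obtain F where F: "finite F" "F \<subseteq> J" "x \<in> local_elements a F" "y \<in> local_elements a F"
      using directed[OF xy] by blast
    show "x + y \<in> L" "x * y \<in> L" using LI[OF F(1,2)] sub(3,4)[OF F(3,4)] by auto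
  qed
  moreover have "0 \<in> L" "1 \<in> L" using LI[of "{}"] sub(1,2) by auto
  moreover have LC: "c *\<^sub>C x \<in> L" "star x \<in> L" if x: "x \<in> L" for x c
  proof -
    obtain F where F: "finite F" "F \<subseteq> J" "x \<in> local_elements a F"
      using x unfolding L_def by blast
    show "c *\<^sub>C x \<in> L" "star x \<in> L" using LI[OF F(1,2)] sub(5,6)[OF F(3)] by auto
  qed
  ultimately have "star_subalgebra L" by (simp add: star_subalgebra_def csubspace_def)
  then have "star_subalgebra (closure L)" by (rule star_subalgebra_closure)
  moreover have "a ` J \<union> star ` a ` J \<subseteq> closure L"
  proof -
    have "a j \<in> local_elements a {j}" for j
      unfolding local_elements_def
      using parity_element.gen[of j "{j}" a] parity_element.zero[of a "{j}" False]
      by (force intro: exI[of _ 0])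
    then have "a j \<in> L" if "j \<in> J" for j
      using that by (intro LI[of "{j}"]) auto
    then have "a j \<in> L \<and> star (a j) \<in> L" if "j \<in> J" for j
      using that LC(2) by blast
    then show ?thesis using closure_subset[of L] by blast
  qed
  ultimately have "cstar_generated (a ` J \<union> star ` a ` J) \<subseteq> closure L"
    unfolding cstar_generated_def by (intro Inter_lower) simp
  then show ?thesis using assms unfolding is_CAR_def L_def by blast
qed

text \<open>Infinity of \<open>J\<close> leaves room for a copy \<open>F'\<close> of
  \<open>F\<close> outside \<open>F \<union> K\<close>; the involution exchanging \<open>F\<close>
  and \<open>F'\<close> along a bijection does the job.\<close>

lemma finitary_perm_displace:
  assumes "infinite J" and "finite F" "F \<subseteq> J" "finite K"
  obtains g where "g \<in> carrier (finitary_perm_group J)" and "g ` F \<inter> K = {}"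
proof -
  obtain F' where F': "finite F'" "card F' = card F" "F' \<subseteq> J - (F \<union> K)"
    using infinite_arbitrarily_large[of "J - (F \<union> K)" "card F"] assms
    by (metis Diff_infinite_finite finite_UnI)
  obtain h where h: "bij_betw h F F'"
    using finite_same_card_bij[OF assms(2) F'(1)] F'(2) by metis
  define g where "g x = (if x \<in> F then h x else if x \<in> F' then inv_into F h x else x)" for x
  have hF: "h x \<in> F'" "inv_into F h (h x) = x" if "x \<in> F" for x
    using h that by (auto simp: bij_betw_def)
  have hF': "inv_into F h x \<in> F" "h (inv_into F h x) = x" if "x \<in> F'" for x
    using h that by (auto simp: bij_betw_def inv_into_into f_inv_into_f)
  have disj: "F \<inter> F' = {}" using F'(3) by blast
  have gg: "g (g x) = x" for x
    using hF hF' disj by (auto simp: g_def)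
  have "g permutes J"
    unfolding permutes_def
  proof (intro conjI allI impI)
    show "g x = x" if "x \<notin> J" for x using that assms(3) F'(3) by (auto simp: g_def)
    show "\<exists>!x. g x = y" for y by (metis gg)
  qed
  moreover have "finite {j. g j \<noteq> j}"
    by (rule finite_subset[of _ "F \<union> F'"]) (use assms F' in \<open>auto simp: g_def\<close>)
  ultimately have "g \<in> carrier (finitary_perm_group J)"
    by (simp add: finitary_perm_group_def)
  moreover have "g ` F \<inter> K = {}" using hF(1) F'(3) by (auto simp: g_def)
  ultimately show ?thesis by (rule that)
qed

text \<open>Each new permutation is made to avoid \<open>K\<close> together with all earlier images
  of \<open>F\<close>.\<close>

lemma finitary_perm_displace_sequence:
  fixes n :: nat
  assumes "infinite J" and "finite F" "F \<subseteq> J" "finite K"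
  shows "\<exists>gs. \<forall>i<n. gs i \<in> carrier (finitary_perm_group J) \<and> gs i ` F \<inter> K = {} \<and>
    (\<forall>j<i. gs i ` F \<inter> gs j ` F = {})"
proof (induction n)
  case (Suc n)
  then obtain gs where gs: "\<forall>i<n. gs i \<in> carrier (finitary_perm_group J) \<and> gs i ` F \<inter> K = {} \<and>
    (\<forall>j<i. gs i ` F \<inter> gs j ` F = {})" by blast
  obtain g where g: "g \<in> carrier (finitary_perm_group J)" "g ` F \<inter> (K \<union> (\<Union>i<n. gs i ` F)) = {}"
    using finitary_perm_displace[OF assms(1-3), of "K \<union> (\<Union>i<n. gs i ` F)"] assms(2,4) by auto
  have disj: "g ` F \<inter> K = {}" "\<And>j. j < n \<Longrightarrow> g ` F \<inter> gs j ` F = {}" using g(2) by blast+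
  show ?case
    using gs g(1) disj by (intro exI[of _ "gs(n := g)"]) (auto simp: less_Suc_eq simp del: image_iff)
qed simp

section \<open>Averaging over displaced copies\<close>

context covariant_representation
begin

section \<open>Norm estimates for sums, commutators and averages\<close>

lemma norm_pi_add_norm_pi_star:
  assumes "x \<in> H"
  shows "complex_of_real ((norm (\<pi> A x))\<^sup>2 + (norm (\<pi> (star A) x))\<^sup>2) =
    cinner x (\<pi> (star A * A + A * star A) x)"
  using pi_star[OF assms pi_in[OF assms], of "star A" A]
    pi_star[OF assms pi_in[OF assms], of A "star A"] assms
  by (simp only: of_real_add power2_norm_cinner pi_add pi_mult pi_in star_star cinner_add_right)

lemma linear_cinner_pi: "x \<in> H \<Longrightarrow> linear (\<lambda>A. cinner x (\<pi> A x))"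
  using linear_compose[OF linear_pi bounded_linear.linear[OF bounded_linear_cinner_right], of x x]
  by (simp add: o_def)

text \<open>Adding \<open>\<parallel>\<pi>(S\<^sup>*) x\<parallel>\<^sup>2\<close> to the left-hand side, where \<open>S\<close> is the sum of the \<open>Z i\<close>, cancels the
  cross terms.\<close>

lemma norm_pi_anticommuting_sum:
  assumes "x \<in> H" and "finite I"
    and anti: "\<And>i j. i \<in> I \<Longrightarrow> j \<in> I \<Longrightarrow> i \<noteq> j \<Longrightarrow> star (Z i) * Z j + Z j * star (Z i) = 0"
  shows "(norm (\<pi> (\<Sum>i\<in>I. Z i) x))\<^sup>2 \<le> (\<Sum>i\<in>I. (norm (\<pi> (Z i) x))\<^sup>2 + (norm (\<pi> (star (Z i)) x))\<^sup>2)"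
proof -
  define S where "S = (\<Sum>i\<in>I. Z i)"
  have star_S: "star S = (\<Sum>i\<in>I. star (Z i))"
    unfolding S_def using linear_sum[OF bounded_linear.linear[OF bounded_linear_star]] by blast
  \<comment> \<open>The sums are swapped so that equal index pairs meet and form the anticommutators
    of \<open>star (Z i)\<close> and \<open>Z j\<close>.\<close>
  have "S * star S = (\<Sum>i\<in>I. \<Sum>j\<in>I. Z j * star (Z i))"
    unfolding star_S unfolding S_def sum_product by (rule sum.swap)
  then have "star S * S + S * star S = (\<Sum>i\<in>I. \<Sum>j\<in>I. star (Z i) * Z j + Z j * star (Z i))"
    unfolding star_S unfolding S_def sum_product by (simp add: sum.distrib)
  also have "\<dots> = (\<Sum>i\<in>I. star (Z i) * Z i + Z i * star (Z i))"
  proof (rule sum.cong[OF refl])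
    fix i assume i: "i \<in> I"
    have "(\<Sum>j\<in>I. star (Z i) * Z j + Z j * star (Z i)) =
        (\<Sum>j\<in>{i}. star (Z i) * Z j + Z j * star (Z i))"
      by (rule sum.mono_neutral_right) (use assms(2) anti i in auto)
    then show "(\<Sum>j\<in>I. star (Z i) * Z j + Z j * star (Z i)) = star (Z i) * Z i + Z i * star (Z i)"
      by simp
  qed
  finally have "complex_of_real ((norm (\<pi> S x))\<^sup>2 + (norm (\<pi> (star S) x))\<^sup>2) =
      (\<Sum>i\<in>I. cinner x (\<pi> (star (Z i) * Z i + Z i * star (Z i)) x))"
    using linear_sum[OF linear_cinner_pi[OF assms(1)]]
    by (simp only: norm_pi_add_norm_pi_star[OF assms(1)])
  also have "\<dots> = complex_of_real (\<Sum>i\<in>I. (norm (\<pi> (Z i) x))\<^sup>2 + (norm (\<pi> (star (Z i)) x))\<^sup>2)"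
    by (simp only: norm_pi_add_norm_pi_star[OF assms(1), symmetric] of_real_sum)
  finally have "(norm (\<pi> S x))\<^sup>2 + (norm (\<pi> (star S) x))\<^sup>2 =
      (\<Sum>i\<in>I. (norm (\<pi> (Z i) x))\<^sup>2 + (norm (\<pi> (star (Z i)) x))\<^sup>2)"
    using of_real_eq_iff by blast
  then show ?thesis unfolding S_def[symmetric] by (metis le_add_same_cancel1 zero_le_power2)
qed

text \<open>The bound \<open>c\<close> concerns the operator \<open>\<pi> Y\<close> and not the norm
  of \<open>Y\<close>, since odd averages are estimated in the representation only.\<close>

lemma norm_pi_commutator_le:
  assumes "\<And>x. x \<in> H \<Longrightarrow> norm (\<pi> Y x) \<le> c * norm x" and "c \<ge> 0" and "x \<in> H"
  shows "norm (\<pi> (Y * B - B * Y) x) \<le> 2 * c * norm B * norm x"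
proof -
  have "norm (\<pi> (Y * B - B * Y) x) \<le> norm (\<pi> Y (\<pi> B x)) + norm (\<pi> B (\<pi> Y x))"
    using assms(3) by (simp add: pi_diff pi_mult norm_triangle_ineq4)
  also have "norm (\<pi> Y (\<pi> B x)) \<le> c * (norm B * norm x)"
    using assms(1)[OF pi_in[OF assms(3)], of B] mult_left_mono[OF norm_pi_le[OF assms(3)] assms(2), of B]
    by linarith
  also have "norm (\<pi> B (\<pi> Y x)) \<le> norm B * (c * norm x)"
    using norm_pi_le[OF pi_in[OF assms(3)], of B Y] mult_left_mono[OF assms(1)[OF assms(3)], of "norm B"]
    by simp
  finally show ?thesis by (simp add: algebra_simps)
qed

definition average :: "(nat \<Rightarrow> 'g) \<Rightarrow> nat \<Rightarrow> 'a \<Rightarrow> 'a" where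
  "average gs n A = (\<Sum>i<n. (1 / real n) *\<^sub>R \<alpha> (gs i) A)"

lemma average_in_orbit_hull:
  assumes "n > 0" and "\<And>i. i < n \<Longrightarrow> gs i \<in> carrier G"
  shows "average gs n A \<in> orbit_hull A"
  unfolding average_def
  by (rule convex_sum) (use assms in \<open>auto simp: convex_orbit_hull alpha_in_orbit_hull\<close>)

lemma average_add:
  assumes "\<And>i. i < n \<Longrightarrow> gs i \<in> carrier G"
  shows "average gs n (A + B) = average gs n A + average gs n B"
  unfolding average_def sum.distrib[symmetric]
  by (rule sum.cong) (use assms in \<open>auto simp: alpha_add scaleR_add_right\<close>)

lemma average_diff:
  assumes "\<And>i. i < n \<Longrightarrow> gs i \<in> carrier G"
  shows "average gs n (A - B) = average gs n A - average gs n B"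
  using average_add[of n gs "A - B" B] assms by (simp add: algebra_simps)

lemma norm_pi_average_le:
  assumes "n > 0" and "\<And>i. i < n \<Longrightarrow> gs i \<in> carrier G" and "x \<in> H"
  shows "norm (\<pi> (average gs n A) x) \<le> norm A * norm x"
  by (rule norm_pi_orbit_hull_le[OF average_in_orbit_hull]) (use assms in auto)

end

locale CAR_representation =
  covariant_representation "finitary_perm_group J" \<alpha> H \<pi> U
  for J :: "'j set"
    and \<alpha> :: "('j \<Rightarrow> 'j) \<Rightarrow> 'a::cstar_algebra \<Rightarrow> 'a"
    and H :: "'h::complex_hilbert set" and \<pi> U +
  fixes a :: "'j \<Rightarrow> 'a"
  assumes infinite_J: "infinite J"
    and is_CAR: "is_CAR J a"
    and alpha_gen: "g \<in> carrier (finitary_perm_group J) \<Longrightarrow> j \<in> J \<Longrightarrow> \<alpha> g (a j) = a (g j)"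
begin

section \<open>Finitary permutations acting on the CAR algebra: averages with small
  commutators\<close>

lemma parity_element_alpha:
  assumes "parity_element a F p x" and "F \<subseteq> J" and "g \<in> carrier (finitary_perm_group J)"
  shows "parity_element a (g ` F) p (\<alpha> g x)"
  by (rule parity_element_image) (use assms star_automorphism alpha_gen in auto)

lemma image_subset_J: "g \<in> carrier (finitary_perm_group J) \<Longrightarrow> F \<subseteq> J \<Longrightarrow> g ` F \<subseteq> J"
  using permutes_in_image[of g J] by (auto simp: finitary_perm_group_def)

text \<open>Displaced odd copies anticommute, so the squared norm of their sum grows like
  \<open>n\<close> and that of the average decays like \<open>2 / n\<close>. The constant 8 makes it
  at most the square of \<open>e / 2\<close>; the half is for the factor 2 in
  \<open>norm_pi_commutator_le\<close>.\<close>

lemma norm_pi_odd_average_le: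
  assumes X: "parity_element a F True X" and "F \<subseteq> J"
    and gs: "\<And>i. i < n \<Longrightarrow> gs i \<in> carrier (finitary_perm_group J)"
    and disj: "\<And>i j. j < i \<Longrightarrow> i < n \<Longrightarrow> gs i ` F \<inter> gs j ` F = {}"
    and n: "n > 0" "8 * (norm X)\<^sup>2 \<le> real n * e\<^sup>2" and "e > 0" and x: "x \<in> H"
  shows "norm (\<pi> (average gs n X) x) \<le> e / 2 * norm x"
proof -
  define Z where "Z i = \<alpha> (gs i) X" for i
  have Z: "parity_element a (gs i ` F) True (Z i)" if "i < n" for i
    unfolding Z_def using X assms(2) gs[OF that] by (rule parity_element_alpha)
  have "(norm (\<pi> (\<Sum>i\<in>{..<n}. Z i) x))\<^sup>2 \<le>
      (\<Sum>i\<in>{..<n}. (norm (\<pi> (Z i) x))\<^sup>2 + (norm (\<pi> (star (Z i)) x))\<^sup>2)"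
  proof (rule norm_pi_anticommuting_sum[OF x])
    fix i j assume ij: "i \<in> {..<n}" "j \<in> {..<n}" "i \<noteq> j"
    have "gs i ` F \<inter> gs j ` F = {}"
    proof (cases "j < i")
      case True
      then show ?thesis using disj ij by simp
    next
      case False
      then have "gs j ` F \<inter> gs i ` F = {}" using disj ij by simp
      then show ?thesis by blast
    qed
    moreover have "gs i ` F \<subseteq> J" "gs j ` F \<subseteq> J" using image_subset_J[OF gs assms(2)] ij by simp_all
    ultimately have "star (Z i) * Z j = - (Z j * star (Z i))"
      using parity_element_commute[OF is_CAR _ _ _ parity_element_star[OF Z] Z] ij by auto
    then show "star (Z i) * Z j + Z j * star (Z i) = 0" by simp
  qed simp
  also have "\<dots> \<le> (\<Sum>i\<in>{..<n}. 2 * (norm X * norm x)\<^sup>2)"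
  proof (rule sum_mono)
    fix i assume "i \<in> {..<n}"
    then have g: "gs i \<in> carrier (finitary_perm_group J)" using gs by simp
    have "norm (\<pi> (Z i) x) \<le> norm X * norm x" unfolding Z_def by (rule norm_pi_alpha_le[OF g x])
    moreover have "norm (\<pi> (star (Z i)) x) \<le> norm X * norm x"
      using norm_pi_alpha_le[OF g x, of "star X"] by (simp add: Z_def alpha_star[OF g] norm_star)
    ultimately have "(norm (\<pi> (Z i) x))\<^sup>2 \<le> (norm X * norm x)\<^sup>2"
      "(norm (\<pi> (star (Z i)) x))\<^sup>2 \<le> (norm X * norm x)\<^sup>2" by (auto intro: power_mono)
    then show "(norm (\<pi> (Z i) x))\<^sup>2 + (norm (\<pi> (star (Z i)) x))\<^sup>2 \<le> 2 * (norm X * norm x)\<^sup>2"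
      by linarith
  qed
  finally have sum: "(norm (\<pi> (\<Sum>i<n. Z i) x))\<^sup>2 \<le> real n * (2 * (norm X * norm x)\<^sup>2)" by simp
  have "average gs n X = (1 / real n) *\<^sub>R (\<Sum>i<n. Z i)"
    by (simp add: average_def Z_def scaleR_sum_right)
  then have "norm (\<pi> (average gs n X) x) = norm (\<pi> (\<Sum>i<n. Z i) x) / real n"
    using x by (simp add: pi_scaleR)
  then have "(norm (\<pi> (average gs n X) x))\<^sup>2 \<le> (real n * (2 * (norm X * norm x)\<^sup>2)) / (real n)\<^sup>2"
    using sum by (simp add: power_divide divide_right_mono)
  also have "\<dots> = (8 * (norm X)\<^sup>2) * (norm x)\<^sup>2 / (4 * real n)"
    using n(1) by (simp add: power2_eq_square)
  also have "\<dots> \<le> (real n * e\<^sup>2) * (norm x)\<^sup>2 / (4 * real n)"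
    using n by (intro divide_right_mono mult_right_mono) auto
  also have "\<dots> = (e / 2 * norm x)\<^sup>2"
    using n(1) by (simp add: power2_eq_square)
  finally show ?thesis
    by (rule power2_le_imp_le) (use \<open>e > 0\<close> in simp)
qed

text \<open>Displaced copies of the even part commute exactly with everything local to
  \<open>K\<close>, and the average of the odd part is small. The same average serves all
  \<open>B\<close> at once.\<close>

lemma local_average_central:
  assumes X: "X \<in> local_elements a F" and F: "finite F" "F \<subseteq> J" and K: "finite K" "K \<subseteq> J"
    and e: "e > 0"
  shows "\<exists>gs n. n > 0 \<and> (\<forall>i<n. gs i \<in> carrier (finitary_perm_group J)) \<and>
    (\<forall>B\<in>local_elements a K. \<forall>x\<in>H.
      norm (\<pi> (average gs n X * B - B * average gs n X) x) \<le> e * norm B * norm x)"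
proof -
  obtain X0 X1 where X01: "X = X0 + X1" "parity_element a F False X0" "parity_element a F True X1"
    using X unfolding local_elements_def by blast
  obtain m where m: "8 * (norm X1)\<^sup>2 / e\<^sup>2 < real m" using reals_Archimedean2 by blast
  define n where "n = Suc m"
  have n: "n > 0" "8 * (norm X1)\<^sup>2 \<le> real n * e\<^sup>2"
  proof -
    have "8 * (norm X1)\<^sup>2 / e\<^sup>2 \<le> real n" using m by (simp add: n_def)
    then show "8 * (norm X1)\<^sup>2 \<le> real n * e\<^sup>2" using e by (simp add: pos_divide_le_eq)
  qed (simp add: n_def)
  obtain gs where "\<forall>i<n. gs i \<in> carrier (finitary_perm_group J) \<and> gs i ` F \<inter> K = {} \<and>
      (\<forall>j<i. gs i ` F \<inter> gs j ` F = {})"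
    using finitary_perm_displace_sequence[OF infinite_J F K(1)] by blast
  then have gs: "\<And>i. i < n \<Longrightarrow> gs i \<in> carrier (finitary_perm_group J)"
    and gK: "\<And>i. i < n \<Longrightarrow> gs i ` F \<inter> K = {}"
    and disj: "\<And>i j. j < i \<Longrightarrow> i < n \<Longrightarrow> gs i ` F \<inter> gs j ` F = {}" by auto
  show ?thesis
  proof (intro exI conjI allI impI ballI)
    show "n > 0" by (rule n(1))
    show "gs i \<in> carrier (finitary_perm_group J)" if "i < n" for i using that by (rule gs)
    fix B x assume B: "B \<in> local_elements a K" and x: "x \<in> H"
    obtain B0 B1 where B01: "B = B0 + B1" "parity_element a K False B0" "parity_element a K True B1"
      using B unfolding local_elements_def by blast
    have "\<alpha> (gs i) X0 * B = B * \<alpha> (gs i) X0" if "i < n" for i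
      using parity_element_commute[OF is_CAR image_subset_J[OF gs[OF that] F(2)] K(2) gK[OF that]
          parity_element_alpha[OF X01(2) F(2) gs[OF that]]] B01
      by (simp add: distrib_left distrib_right)
    then have "average gs n X0 * B = B * average gs n X0"
      by (simp add: average_def sum_distrib_left sum_distrib_right)
    \<comment> \<open>The even part drops out of the commutator, leaving the average of
      \<open>X1\<close>.\<close>
    moreover have "average gs n X = average gs n X0 + average gs n X1"
      unfolding X01(1) using gs by (rule average_add)
    ultimately have "average gs n X * B - B * average gs n X =
        average gs n X1 * B - B * average gs n X1"
      by (simp add: algebra_simps)
    moreover have "norm (\<pi> (average gs n X1 * B - B * average gs n X1) x) \<le>
        2 * (e / 2) * norm B * norm x"
      by (rule norm_pi_commutator_le[OF norm_pi_odd_average_le[OF X01(3) F(2) gs disj n e]])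
        (use e x in auto)
    ultimately show "norm (\<pi> (average gs n X * B - B * average gs n X) x) \<le> e * norm B * norm x"
      by simp
  qed
qed

lemma local_approximation:
  assumes "\<delta> > 0"
  obtains F A' where "finite F" "F \<subseteq> J" "A' \<in> local_elements a F" "norm (A - A') < \<delta>"
proof -
  have "A \<in> closure (\<Union>F\<in>{F. finite F \<and> F \<subseteq> J}. local_elements a F)"
    by (simp add: local_elements_dense[OF is_CAR])
  then obtain A' where "A' \<in> (\<Union>F\<in>{F. finite F \<and> F \<subseteq> J}. local_elements a F)" "dist A' A < \<delta>"
    using assms unfolding closure_approachable by blast
  then show ?thesis using that by (auto simp: dist_norm norm_minus_commute)
qed

text \<open>Density passes from local elements to arbitrary ones. Since \<B> is finite, one finite
  set \<open>K\<close> supports local approximants of all its members.\<close>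

sublocale asymptotically_central_representation "finitary_perm_group J" \<alpha> H \<pi> U
proof unfold_locales
  fix \<B> :: "'a set" and e :: real and X :: 'a
  assume \<B>: "finite \<B>" and e: "e > 0"
  define M where "M = norm X + (\<Sum>B\<in>\<B>. norm B) + 1"
  have M: "M \<ge> 1" by (simp add: M_def sum_nonneg)
  \<comment> \<open>The minimum with 1 bounds the approximants by the original norms plus 1. The
    three errors below add up to at most \<open>3 * \<delta> * M\<close>, hence to at most
    \<open>3 * e / 4\<close>.\<close>
  define \<delta> where "\<delta> = min 1 (e / (4 * M))"
  have \<delta>: "\<delta> > 0" "\<delta> \<le> 1" "\<delta> * M \<le> e / 4"
  proof -
    have "\<delta> * M \<le> e / (4 * M) * M" using M by (intro mult_right_mono) (auto simp: \<delta>_def)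
    moreover have "e / (4 * M) * M = e / 4" using M by (simp add: field_simps)
    ultimately show "\<delta> * M \<le> e / 4" by linarith
  qed (use e M in \<open>auto simp: \<delta>_def\<close>)
  obtain F X' where F: "finite F" "F \<subseteq> J" "X' \<in> local_elements a F" "norm (X - X') < \<delta>"
    using local_approximation[OF \<delta>(1)] by blast
  have "\<forall>B. \<exists>K B'. finite K \<and> K \<subseteq> J \<and> B' \<in> local_elements a K \<and> norm (B - B') < \<delta>"
    using local_approximation[OF \<delta>(1)] by metis
  then obtain k b where kb: "\<And>B. finite (k B)" "\<And>B. k B \<subseteq> J" "\<And>B. b B \<in> local_elements a (k B)"
    "\<And>B. norm (B - b B) < \<delta>"
    by metis
  define K where "K = (\<Union>B\<in>\<B>. k B)"
  have K: "finite K" "K \<subseteq> J" using \<B> kb(1,2) by (auto simp: K_def)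
  from local_average_central[OF F(3,1,2) K \<delta>(1)]
  obtain gs n where n: "n > 0" and "\<forall>i<n. gs i \<in> carrier (finitary_perm_group J)"
    and comm: "\<forall>B\<in>local_elements a K. \<forall>x\<in>H.
      norm (\<pi> (average gs n X' * B - B * average gs n X') x) \<le> \<delta> * norm B * norm x"
    by (elim exE conjE)
  then have gs: "\<And>i. i < n \<Longrightarrow> gs i \<in> carrier (finitary_perm_group J)" by blast
  show "\<exists>Y\<in>orbit_hull X. \<forall>B\<in>\<B>. \<forall>x\<in>H. norm (\<pi> (Y * B - B * Y) x) \<le> e * norm x"
  proof (intro bexI ballI)
    show "average gs n X \<in> orbit_hull X" using n gs by (rule average_in_orbit_hull)
    fix B x assume B: "B \<in> \<B>" and x: "x \<in> H"
    \<comment> \<open>\<open>X\<close> and its approximant are averaged with the same permutations,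
      so \<open>Y - Y'\<close> is the average of the small element \<open>X - X'\<close>.\<close>
    define Y Y' D where "Y = average gs n X" and "Y' = average gs n X'" and "D = B - b B"
    have YY': "Y - Y' = average gs n (X - X')"
      unfolding Y_def Y'_def by (rule average_diff[symmetric]) (rule gs)
    have 1: "norm (\<pi> ((Y - Y') * B - B * (Y - Y')) x) \<le> 2 * norm (X - X') * norm B * norm x"
      unfolding YY' using n gs x by (intro norm_pi_commutator_le norm_pi_average_le) auto
    have 2: "norm (\<pi> (Y' * D - D * Y') x) \<le> 2 * norm X' * norm D * norm x"
      unfolding Y'_def using n gs x by (intro norm_pi_commutator_le norm_pi_average_le) auto
    have 3: "norm (\<pi> (Y' * b B - b B * Y') x) \<le> \<delta> * norm (b B) * norm x"
    proof -
      have "k B \<subseteq> K" using B by (auto simp: K_def)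
      then have "b B \<in> local_elements a K" using kb(3)[of B] local_elements_mono by blast
      then show ?thesis unfolding Y'_def using comm x by blast
    qed
    have "Y * B - B * Y = ((Y - Y') * B - B * (Y - Y')) + (Y' * D - D * Y') + (Y' * b B - b B * Y')"
      by (simp add: D_def algebra_simps)
    then have "norm (\<pi> (Y * B - B * Y) x) \<le> norm (\<pi> ((Y - Y') * B - B * (Y - Y')) x)
        + norm (\<pi> (Y' * D - D * Y') x) + norm (\<pi> (Y' * b B - b B * Y') x)"
      using x by (simp only: pi_add) (meson add_mono norm_triangle_ineq norm_triangle_le order_refl)
    also have "\<dots> \<le> (2 * norm (X - X') * norm B + 2 * norm X' * norm D + \<delta> * norm (b B)) * norm x"
      using 1 2 3 by (simp add: distrib_right)
    also have "\<dots> \<le> e * norm x"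
    proof (rule mult_right_mono)
      have BM: "norm B \<le> (\<Sum>B\<in>\<B>. norm B)" using B \<B> by (intro member_le_sum) auto
      have X': "norm X' \<le> norm X + 1"
        using norm_triangle_ineq2[of X' X] F(4) \<delta>(2) by (simp add: norm_minus_commute)
      have "norm (b B) \<le> norm B + 1"
        using norm_triangle_ineq2[of "b B" B] kb(4)[of B] \<delta>(2) by (simp add: norm_minus_commute)
      then have b: "norm (b B) \<le> M"
        using BM norm_ge_zero[of X] unfolding M_def by linarith
      have "norm (X - X') * norm B \<le> \<delta> * norm B" using F(4) by (intro mult_right_mono) auto
      moreover have "norm X' * norm D \<le> (norm X + 1) * \<delta>"
        using X' kb(4)[of B] \<delta>(1) by (intro mult_mono) (auto simp: D_def)
      moreover have "\<delta> * norm (b B) \<le> \<delta> * M" using b \<delta>(1) by (intro mult_left_mono) auto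
      moreover have "\<delta> * (norm B + (norm X + 1)) \<le> \<delta> * M"
        using BM \<delta>(1) by (intro mult_left_mono) (auto simp: M_def)
      ultimately show "2 * norm (X - X') * norm B + 2 * norm X' * norm D + \<delta> * norm (b B) \<le> e"
        using \<delta>(3) e by (simp add: algebra_simps)
    qed simp
    finally show "norm (\<pi> (average gs n X * B - B * average gs n X) x) \<le> e * norm x"
      by (simp add: Y_def)
  qed
qed

end

section \<open>Both properties, read off in each covariant GNS representation\<close>

theorem theorem4p2:
  fixes J :: "'j set"
    and a :: "'j \<Rightarrow> 'a::cstar_algebra"
    and \<alpha> :: "('j \<Rightarrow> 'j) \<Rightarrow> 'a \<Rightarrow> 'a"
  assumes "infinite J"
    and "is_CAR J a"
    and "cstar_action (finitary_perm_group J) \<alpha>"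
    and "\<And>g j. g \<in> carrier (finitary_perm_group J) \<Longrightarrow> j \<in> J \<Longrightarrow> \<alpha> g (a j) = a (g j)"
  shows "large_group_of_automorphisms TYPE('h::complex_hilbert) (finitary_perm_group J) \<alpha>
       \<and> G_abelian TYPE('h) (finitary_perm_group J) \<alpha>"
proof -
  \<comment> \<open>Every covariant GNS quadruple is an instance of the locale, so the results on
    asymptotically central representations apply to it.\<close>
  have *: "CAR_representation J \<alpha> H \<pi> U a"
    if "gns_quadruple (finitary_perm_group J) \<alpha> \<phi> H \<pi> U \<Omega>"
    for \<phi> \<Omega> U \<pi> and H :: "'h set"
    by unfold_locales
      (use that assms in \<open>simp_all add: gns_quadruple_def gns_triple_def\<close>)
  show ?thesis
    unfolding large_group_of_automorphisms_def G_abelian_def Let_def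
  proof (intro conjI allI impI ballI assms(3))
    fix A :: 'a and \<phi> \<pi> U \<Omega> and H :: "'h set"
    assume q: "gns_quadruple (finitary_perm_group J) \<alpha> \<phi> H \<pi> U \<Omega>"
    then interpret CAR_representation J \<alpha> H \<pi> U a by (rule *)
    show "weak_operator_topology H closure_of
        conv_ops {\<pi> (\<alpha> g A) | g. g \<in> carrier (finitary_perm_group J)} \<inter> commutant H (range \<pi>) \<noteq> {}"
      by (rule weak_closure_meets_commutant[of \<Omega>])
        (use q in \<open>simp_all add: gns_quadruple_def gns_triple_def fixed_vectors_def\<close>)
  next
    fix A B :: 'a and \<phi> \<pi> U \<Omega> x and H :: "'h set"
    assume q: "gns_quadruple (finitary_perm_group J) \<alpha> \<phi> H \<pi> U \<Omega>" and x: "x \<in> H"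
    from q interpret CAR_representation J \<alpha> H \<pi> U a by (rule *)
    show "(E \<circ> \<pi> A \<circ> E) ((E \<circ> \<pi> B \<circ> E) x) = (E \<circ> \<pi> B \<circ> E) ((E \<circ> \<pi> A \<circ> E) x)"
      using x by (rule compression_commute)
  qed
qed

end
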